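(* Let $d\ge2$ and let $\beta_c$ be the critical inverse temperature of the Ising model on $\mathbb{Z}^d$. For any $\beta\in[0,\beta_c)$ there exist $C,m\in(0,\infty)$ such that for all finite $V\subset\mathbb{Z}^d$ and all $h:V\to\mathbb{R}$, the Ising measures $\mu^{\cdot,h}_{V,\beta}$ satisfy the strong spatial mixing property $SM(V,C,m)$; that is, for every $\Delta\subset V$ and every $y\in\partial V$, $$\sup_{\tau:\partial V\to\{\pm1\}}\big\|\mu^{\tau,h}_{V,\beta}|_\Delta-\mu^{\tau^y,h}_{V,\beta}|_\Delta\big\|_{TV}\le Ce^{-m\,d(\Delta,y)}.$$
   Context: For finite $V\subset\mathbb{Z}^d$, its external boundary is $\partial V:=\{x\in\mathbb{Z}^d\setminus V:|x-y|_1=1\text{ for some }y\in V\}$, where $|\cdot|_1$ is the $\ell^1$ norm. For a boundary condition $\tau:\partial V\to\{\pm1\}$, external field $h:V\to\mathbb{R}$ and inverse temperature $\beta$, the Ising measure $\mu^{\tau,h}_{V,\beta}$ (with coupling constants $J\equiv1$) is the probability measure on $\sigma\in\{\pm1\}^V$ proportional to $$\exp\Big\{\beta\sum_{\{x,y\}}\sigma_x\sigma_y+\sum_{x\in V}h_x\sigma_x\Big\},$$ where the first sum is over unordered pairs with $|x-y|_1=1$, $x,y\in V\cup\partial V$ and at least one of $x,y$ in $V$, and $\sigma_x:=\tau_x$ for $x\in\partial V$. $\mu^{\tau,h}_{V,\beta}|_\Delta$ is the marginal law of $(\sigma_v)_{v\in\Delta}$ under $\mu^{\tau,h}_{V,\beta}$;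 $\tau^y$ is obtained from $\tau$ by flipping the spin $\tau_y$; $\|\cdot\|_{TV}$ is the total variation distance; and $d(\Delta,y):=\min_{x\in\Delta}|x-y|_1$ (for $\Delta=\emptyset$ the left-hand side is $0$ and the inequality is understood to hold trivially). The critical inverse temperature is $\beta_c=\sup\{\beta\ge0:\lim_{N\to\infty}\langle\sigma_0\rangle^{+}_{\Lambda_N,\beta}=0\}$, where $\langle\cdot\rangle^+_{\Lambda_N,\beta}$ is expectation under $\mu^{\tau,0}_{\Lambda_N,\beta}$ with $\Lambda_N=[-N,N]^d\cap\mathbb{Z}^d$, $\tau\equiv+1$ and zero external field. *)

theory Defs
  imports "HOL-Probability.Probability"
begin

text \<open>
  The lattice \<open>\<int>\<^sup>d\<close> is \<open>int ^ 'd\<close> with \<open>d = CARD('d)\<close>. Finite-volume spin configurations on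
  \<open>S\<close> are the functions in \<open>S \<rightarrow>\<^sub>E {-1, 1}\<close>, i.e. they are \<open>undefined\<close> outside \<open>S\<close>.
\<close>

definition l1_norm :: "int ^ 'd \<Rightarrow> int" where
  "l1_norm x = (\<Sum>i\<in>UNIV. \<bar>x $ i\<bar>)"

definition ext_boundary :: "(int ^ 'd) set \<Rightarrow> (int ^ 'd) set" where
  "ext_boundary V = {x. x \<notin> V \<and> (\<exists>y\<in>V. l1_norm (x - y) = 1)}"

definition spin_configs :: "(int ^ 'd) set \<Rightarrow> (int ^ 'd \<Rightarrow> real) set" where
  "spin_configs S = S \<rightarrow>\<^sub>E {-1, 1}"

text \<open>Unordered nearest-neighbour pairs are represented as two-element sets.\<close>

definition ising_edges :: "(int ^ 'd) set \<Rightarrow> (int ^ 'd) set set" where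
  "ising_edges V = {{x, y} | x y.
     x \<in> V \<union> ext_boundary V \<and> y \<in> V \<union> ext_boundary V \<and>
     (x \<in> V \<or> y \<in> V) \<and> l1_norm (x - y) = 1}"

definition glue_spins ::
    "(int ^ 'd) set \<Rightarrow> (int ^ 'd \<Rightarrow> real) \<Rightarrow> (int ^ 'd \<Rightarrow> real) \<Rightarrow> int ^ 'd \<Rightarrow> real" where
  "glue_spins V \<tau> \<sigma> x = (if x \<in> V then \<sigma> x else \<tau> x)"

text \<open>
  The product over an edge \<open>{x, y}\<close> is \<open>\<sigma>\<^sub>x \<sigma>\<^sub>y\<close>. The external field is not multiplied by \<open>\<beta>\<close>,
  and only its values on \<open>V\<close> enter.
\<close>

definition ising_weight ::
    "(int ^ 'd) set \<Rightarrow> real \<Rightarrow> (int ^ 'd \<Rightarrow> real) \<Rightarrow> (int ^ 'd \<Rightarrow> real) \<Rightarrow> (int ^ 'd \<Rightarrow> real) \<Rightarrow> real" where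
  "ising_weight V \<beta> h \<tau> \<sigma> =
     exp (\<beta> * (\<Sum>e\<in>ising_edges V. \<Prod>x\<in>e. glue_spins V \<tau> \<sigma> x) + (\<Sum>x\<in>V. h x * \<sigma> x))"

definition ising_partition_function ::
    "(int ^ 'd) set \<Rightarrow> real \<Rightarrow> (int ^ 'd \<Rightarrow> real) \<Rightarrow> (int ^ 'd \<Rightarrow> real) \<Rightarrow> real" where
  "ising_partition_function V \<beta> h \<tau> = (\<Sum>\<sigma>\<in>spin_configs V. ising_weight V \<beta> h \<tau> \<sigma>)"

definition ising_measure ::
    "(int ^ 'd) set \<Rightarrow> real \<Rightarrow> (int ^ 'd \<Rightarrow> real) \<Rightarrow> (int ^ 'd \<Rightarrow> real) \<Rightarrow> (int ^ 'd \<Rightarrow> real) measure" where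
  "ising_measure V \<beta> h \<tau> =
     point_measure (spin_configs V)
       (\<lambda>\<sigma>. ennreal (ising_weight V \<beta> h \<tau> \<sigma> / ising_partition_function V \<beta> h \<tau>))"

definition marginal ::
    "(int ^ 'd \<Rightarrow> real) measure \<Rightarrow> (int ^ 'd) set \<Rightarrow> (int ^ 'd \<Rightarrow> real) measure" where
  "marginal \<mu> \<Delta> = distr \<mu> (count_space (spin_configs \<Delta>)) (\<lambda>\<sigma>. restrict \<sigma> \<Delta>)"

text \<open>For probability measures \<open>M\<close> and \<open>N\<close> on the same measurable space.\<close>

definition tv_dist :: "'a measure \<Rightarrow> 'a measure \<Rightarrow> real" where
  "tv_dist M N = (SUP A\<in>sets M. \<bar>measure M A - measure N A\<bar>)"

definition flip_spin :: "(int ^ 'd \<Rightarrow> real) \<Rightarrow> int ^ 'd \<Rightarrow> int ^ 'd \<Rightarrow> real" where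
  "flip_spin \<tau> y = \<tau>(y := - \<tau> y)"

text \<open>Only meaningful for finite nonempty \<open>\<Delta>\<close>.\<close>

definition l1_setdist :: "(int ^ 'd) set \<Rightarrow> int ^ 'd \<Rightarrow> int" where
  "l1_setdist \<Delta> y = Min ((\<lambda>x. l1_norm (x - y)) ` \<Delta>)"

text \<open>
  The property \<open>SM(V, C, m)\<close> of a family \<open>\<mu>\<close> of measures on spin configurations on \<open>V\<close>, indexed
  by boundary conditions. The distance to \<open>\<Delta> = {}\<close> is an unspecified integer; since both
  marginals on \<open>{}\<close> are then the same point mass, the inequality holds for \<open>C \<ge> 0\<close> whatever
  that integer is.
\<close>

definition strong_spatial_mixing ::
    "(int ^ 'd) set \<Rightarrow> ((int ^ 'd \<Rightarrow> real) \<Rightarrow> (int ^ 'd \<Rightarrow> real) measure) \<Rightarrow> real \<Rightarrow> real \<Rightarrow> bool" where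
  "strong_spatial_mixing V \<mu> C m \<longleftrightarrow>
     (\<forall>\<Delta> y. \<Delta> \<subseteq> V \<longrightarrow> y \<in> ext_boundary V \<longrightarrow>
        (SUP \<tau>\<in>spin_configs (ext_boundary V).
           tv_dist (marginal (\<mu> \<tau>) \<Delta>) (marginal (\<mu> (flip_spin \<tau> y)) \<Delta>))
        \<le> C * exp (- m * real_of_int (l1_setdist \<Delta> y)))"

definition lattice_box :: "nat \<Rightarrow> (int ^ 'd) set" where
  "lattice_box N = {x. \<forall>i. - int N \<le> x $ i \<and> x $ i \<le> int N}"

definition plus_magnetization :: "'d::finite itself \<Rightarrow> nat \<Rightarrow> real \<Rightarrow> real" where
  "plus_magnetization _ N \<beta> =
     (let \<Lambda> = lattice_box N :: (int ^ 'd) set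
      in \<integral>\<sigma>. \<sigma> 0 \<partial>ising_measure \<Lambda> \<beta> (\<lambda>_. 0) (\<lambda>x\<in>ext_boundary \<Lambda>. 1))"

text \<open>
  The supremum is taken in the extended reals, so that it carries no finiteness claim
  (for \<open>d = 1\<close> it is infinite).
\<close>

definition critical_beta :: "'d::finite itself \<Rightarrow> ereal" where
  "critical_beta d =
     Sup (ereal ` {\<beta>. 0 \<le> \<beta> \<and> (\<lambda>N. plus_magnetization d N \<beta>) \<longlonglongrightarrow> 0})"

lemma finite_lattice_box: "finite (lattice_box N :: (int ^ 'd::finite) set)"
proof (rule finite_imageD)
  show "finite (vec_nth ` (lattice_box N :: (int ^ 'd) set))"
    by (rule finite_subset[of _ "UNIV \<rightarrow>\<^sub>E {- int N..int N}"])
      (auto simp: lattice_box_def intro!: finite_PiE)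
qed (simp add: inj_on_def vec_nth_inject)

lemma finite_ext_boundary:
  fixes V :: "(int ^ 'd::finite) set"
  assumes "finite V"
  shows "finite (ext_boundary V)"
proof (rule finite_subset)
  show "ext_boundary V \<subseteq> (\<Union>y\<in>V. (\<lambda>z. z + y) ` lattice_box 1)"
  proof
    fix x assume "x \<in> ext_boundary V"
    then obtain y where y: "y \<in> V" "l1_norm (x - y) = 1"
      by (auto simp: ext_boundary_def)
    have "- 1 \<le> (x - y) $ i \<and> (x - y) $ i \<le> 1" for i
      using member_le_sum[of i UNIV "\<lambda>i. \<bar>(x - y) $ i\<bar>"] y(2) by (simp add: l1_norm_def abs_le_iff)
    then have "x - y \<in> lattice_box 1"
      by (simp add: lattice_box_def)
    then have "x \<in> (\<lambda>z. z + y) ` lattice_box 1"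
      by (rule rev_image_eqI) simp
    with y(1) show "x \<in> (\<Union>y\<in>V. (\<lambda>z. z + y) ` lattice_box 1)" by blast
  qed
qed (use assms finite_lattice_box in auto)

lemma finite_ising_edges:
  fixes V :: "(int ^ 'd::finite) set"
  assumes "finite V"
  shows "finite (ising_edges V)"
  by (rule finite_subset[of _ "Pow (V \<union> ext_boundary V)"])
    (use assms finite_ext_boundary in \<open>auto simp: ising_edges_def\<close>)

lemma finite_spin_configs: "finite S \<Longrightarrow> finite (spin_configs S)"
  by (auto simp: spin_configs_def intro!: finite_PiE)

lemma prob_space_ising_measure:
  fixes V :: "(int ^ 'd::finite) set"
  assumes "finite V"
  shows "prob_space (ising_measure V \<beta> h \<tau>)"
proof
  have fin: "finite (spin_configs V)" using assms by (rule finite_spin_configs)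
  have ne: "spin_configs V \<noteq> {}" by (simp add: spin_configs_def PiE_eq_empty_iff)
  have pos: "ising_partition_function V \<beta> h \<tau> > 0"
    unfolding ising_partition_function_def
    by (rule sum_pos[OF fin ne]) (simp add: ising_weight_def)
  have nonneg: "0 \<le> ising_weight V \<beta> h \<tau> \<sigma> / ising_partition_function V \<beta> h \<tau>" for \<sigma>
    using pos by (simp add: ising_weight_def)
  have "emeasure (ising_measure V \<beta> h \<tau>) (space (ising_measure V \<beta> h \<tau>)) =
      ennreal (\<Sum>\<sigma>\<in>spin_configs V. ising_weight V \<beta> h \<tau> \<sigma> / ising_partition_function V \<beta> h \<tau>)"
    unfolding ising_measure_def
    by (simp add: space_point_measure emeasure_point_measure_finite fin nonneg)
  also have "\<dots> = 1"
    using pos by (simp flip: sum_divide_distrib add: ising_partition_function_def)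
  finally show "emeasure (ising_measure V \<beta> h \<tau>) (space (ising_measure V \<beta> h \<tau>)) = 1" .
qed

end

theory Submission
  imports Defs
begin

text \<open>
  Write a configuration as its set of plus spins. Splitting on the spin at a vertex \<open>w\<close> expresses
  a Gibbs measure as a mixture of two Gibbs measures on the remaining vertices. If the field \<open>a w\<close> at
  \<open>w\<close> is nonnegative, the measure is a mixture of the one in which \<open>a w\<close> is deleted and the one in
  which \<open>w\<close> is pinned to plus (contracted). Inequalities (1) and (2) follow by induction on deletion
  and contraction.

  (1) The Ding-Song-Sun inequality: changing the field from \<open>h - a\<close> to \<open>h + a\<close> with \<open>a \<ge> 0\<close> moves a
  magnetization the most when \<open>h = 0\<close>. The spin at \<open>y\<close> on the boundary acts as such a field, so its
  influence is at most the influence in zero field.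

  (2) The differential inequality of Duminil-Copin and Tassion. With
  \<open>\<phi>\<^sub>\<beta>(S) = \<beta> \<Sum>\<^bsub>x\<in>S, y\<notin>S, x~y\<^esub> \<langle>\<sigma>\<^sub>0\<sigma>\<^sub>x\<rangle>\<^sub>S\<close>, if \<open>\<phi>\<^sub>\<beta>(S) \<ge> 1\<close> for all finite \<open>S\<close> containing the origin,
  then the plus magnetization at each larger inverse temperature is bounded below uniformly in the
  volume. Hence \<open>\<beta> < \<beta>\<^sub>c\<close> yields a set \<open>S\<close> with \<open>\<phi>\<^sub>\<beta>(S) < 1\<close>.

  (3) By the FKG inequality, (1) gives the Simon-Lieb inequality, which iterated over translates
  of such an \<open>S\<close> gives exponential decay in every finite volume.

  Revealing the spins of \<open>\<Delta>\<close> one at a time bounds the total variation distance by the sum over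
  \<open>x \<in> \<Delta>\<close> of the zero-field influences on \<open>x\<close>, and the sum of the exponential bounds converges.
\<close>

section \<open>Finite Gibbs measures\<close>

definition spin :: "'a set \<Rightarrow> 'a \<Rightarrow> real" where
  "spin A x = (if x \<in> A then 1 else -1)"

text \<open>
  The factor 1/2 compensates for the sum over ordered pairs. The field \<open>f\<close> may be negative; boundary
  conditions enter only through it.
\<close>

definition energy :: "('a \<Rightarrow> 'a \<Rightarrow> real) \<Rightarrow> 'a set \<Rightarrow> ('a \<Rightarrow> real) \<Rightarrow> 'a set \<Rightarrow> real" where
  "energy J V f A =
     (\<Sum>x\<in>V. \<Sum>y\<in>V. J x y * (spin A x * spin A y)) / 2 + (\<Sum>x\<in>V. f x * spin A x)"

definition wsum :: "('a \<Rightarrow> 'a \<Rightarrow> real) \<Rightarrow> 'a set \<Rightarrow> ('a \<Rightarrow> real) \<Rightarrow> ('a set \<Rightarrow> real) \<Rightarrow> real" where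
  "wsum J V f g = (\<Sum>A\<in>Pow V. exp (energy J V f A) * g A)"

abbreviation pfun :: "('a \<Rightarrow> 'a \<Rightarrow> real) \<Rightarrow> 'a set \<Rightarrow> ('a \<Rightarrow> real) \<Rightarrow> real" where
  "pfun J V f \<equiv> wsum J V f (\<lambda>_. 1)"

definition gibbs :: "('a \<Rightarrow> 'a \<Rightarrow> real) \<Rightarrow> 'a set \<Rightarrow> ('a \<Rightarrow> real) \<Rightarrow> ('a set \<Rightarrow> real) \<Rightarrow> real" where
  "gibbs J V f g = wsum J V f g / pfun J V f"

definition gcov :: "('a \<Rightarrow> 'a \<Rightarrow> real) \<Rightarrow> 'a set \<Rightarrow> ('a \<Rightarrow> real) \<Rightarrow> ('a set \<Rightarrow> real) \<Rightarrow> ('a set \<Rightarrow> real) \<Rightarrow> real" where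
  "gcov J V f g k = gibbs J V f (\<lambda>A. g A * k A) - gibbs J V f g * gibbs J V f k"

abbreviation mag :: "('a \<Rightarrow> 'a \<Rightarrow> real) \<Rightarrow> 'a set \<Rightarrow> ('a \<Rightarrow> real) \<Rightarrow> 'a \<Rightarrow> real" where
  "mag J V f x \<equiv> gibbs J V f (\<lambda>A. spin A x)"

abbreviation corr :: "('a \<Rightarrow> 'a \<Rightarrow> real) \<Rightarrow> 'a set \<Rightarrow> 'a \<Rightarrow> 'a \<Rightarrow> real" where
  "corr J V x y \<equiv> gibbs J V (\<lambda>_. 0) (\<lambda>A. spin A x * spin A y)"

lemma spin_sq [simp]: "spin A x * spin A x = 1"
  by (simp add: spin_def)

lemma spin_compl: "x \<in> V \<Longrightarrow> spin (V - A) x = - spin A x"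
  by (simp add: spin_def)

lemma spin_mono: "A \<subseteq> B \<Longrightarrow> spin A x \<le> spin B x"
  by (auto simp: spin_def)

lemma wsum_cong:
  assumes "\<And>A. A \<subseteq> V \<Longrightarrow> g A = k A" "\<And>x. x \<in> V \<Longrightarrow> f x = f' x"
    "\<And>x y. x \<in> V \<Longrightarrow> y \<in> V \<Longrightarrow> J x y = J' x y"
  shows "wsum J V f g = wsum J' V f' k"
  unfolding wsum_def energy_def using assms by (intro sum.cong) (auto cong: sum.cong)

lemma gibbs_cong:
  assumes "\<And>A. A \<subseteq> V \<Longrightarrow> g A = k A" "\<And>x. x \<in> V \<Longrightarrow> f x = f' x"
    "\<And>x y. x \<in> V \<Longrightarrow> y \<in> V \<Longrightarrow> J x y = J' x y"
  shows "gibbs J V f g = gibbs J' V f' k"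
  unfolding gibbs_def by (intro arg_cong2[of _ _ _ _ "(/)"] wsum_cong assms refl)

lemma gibbs_cong_fun: "(\<And>A. A \<subseteq> V \<Longrightarrow> g A = k A) \<Longrightarrow> gibbs J V f g = gibbs J V f k"
  by (rule gibbs_cong) auto

lemma gibbs_cong_field: "(\<And>x. x \<in> V \<Longrightarrow> f x = f' x) \<Longrightarrow> gibbs J V f g = gibbs J V f' g"
  by (rule gibbs_cong) auto

lemma pfun_pos: "finite V \<Longrightarrow> 0 < pfun J V f"
  unfolding wsum_def by (rule sum_pos) auto

lemma wsum_add: "wsum J V f (\<lambda>A. g A + k A) = wsum J V f g + wsum J V f k"
  by (simp add: wsum_def algebra_simps sum.distrib)

lemma wsum_cmult: "wsum J V f (\<lambda>A. c * g A) = c * wsum J V f g"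
  by (simp add: wsum_def sum_distrib_left mult.left_commute)

lemma gibbs_add: "gibbs J V f (\<lambda>A. g A + k A) = gibbs J V f g + gibbs J V f k"
  by (simp add: gibbs_def wsum_add add_divide_distrib)

lemma gibbs_cmult: "gibbs J V f (\<lambda>A. c * g A) = c * gibbs J V f g"
  by (simp add: gibbs_def wsum_cmult)

lemma gibbs_cmult_right: "gibbs J V f (\<lambda>A. g A * c) = gibbs J V f g * c"
  using gibbs_cmult[of J V f c g] by (simp add: mult.commute)

lemma gibbs_minus: "gibbs J V f (\<lambda>A. - g A) = - gibbs J V f g"
  using gibbs_cmult[of J V f "-1" g] by simp

lemma gibbs_diff: "gibbs J V f (\<lambda>A. g A - k A) = gibbs J V f g - gibbs J V f k"
  using gibbs_add[of J V f g "\<lambda>A. - k A"] by (simp add: gibbs_minus)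

lemma gibbs_sum: "gibbs J V f (\<lambda>A. \<Sum>i\<in>I. g i A) = (\<Sum>i\<in>I. gibbs J V f (g i))"
proof -
  have "wsum J V f (\<lambda>A. \<Sum>i\<in>I. g i A) = (\<Sum>i\<in>I. wsum J V f (g i))"
    unfolding wsum_def sum_distrib_left by (rule sum.swap)
  then show ?thesis by (simp add: gibbs_def sum_divide_distrib)
qed

lemma gibbs_const: "finite V \<Longrightarrow> gibbs J V f (\<lambda>_. c) = c"
  using wsum_cmult[of J V f c "\<lambda>_. 1"] pfun_pos[of V J f] by (simp add: gibbs_def)

lemma gibbs_mono:
  assumes "finite V" "\<And>A. A \<subseteq> V \<Longrightarrow> g A \<le> k A"
  shows "gibbs J V f g \<le> gibbs J V f k"
proof -
  have "wsum J V f g \<le> wsum J V f k"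
    unfolding wsum_def using assms by (intro sum_mono mult_left_mono) auto
  then show ?thesis
    using pfun_pos[OF assms(1), of J f] by (simp add: gibbs_def divide_right_mono)
qed

lemma gibbs_bounds:
  assumes "finite V" "\<And>A. A \<subseteq> V \<Longrightarrow> lo \<le> g A" "\<And>A. A \<subseteq> V \<Longrightarrow> g A \<le> hi"
  shows "lo \<le> gibbs J V f g" "gibbs J V f g \<le> hi"
  using gibbs_mono[of V "\<lambda>_. lo" g J f] gibbs_mono[of V g "\<lambda>_. hi" J f] assms
  by (simp_all add: gibbs_const)

lemma mag_le_1: "finite V \<Longrightarrow> mag J V f x \<le> 1"
  by (rule gibbs_bounds(2)[of _ "-1"]) (auto simp: spin_def)

text \<open>The global flip sends the plus set \<open>A\<close> to \<open>V - A\<close>; it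
  preserves the pair energy and reverses the field.\<close>

lemma wsum_flip: "wsum J V (\<lambda>x. - f x) g = wsum J V f (\<lambda>A. g (V - A))"
proof -
  have bij: "bij_betw (\<lambda>A. V - A) (Pow V) (Pow V)"
    by (rule bij_betw_byWitness[where f' = "\<lambda>A. V - A"]) auto
  have "energy J V (\<lambda>x. - f x) (V - A) = energy J V f A" for A
    unfolding energy_def by (simp add: spin_compl cong: sum.cong)
  then show ?thesis
    unfolding wsum_def by (subst sum.reindex_bij_betw[OF bij, symmetric]) simp
qed

lemma gibbs_flip: "gibbs J V (\<lambda>x. - f x) g = gibbs J V f (\<lambda>A. g (V - A))"
  by (simp add: gibbs_def wsum_flip)

lemma pfun_flip: "pfun J V (\<lambda>x. - f x) = pfun J V f"
  by (rule wsum_flip)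

lemma mag_flip: "x \<in> V \<Longrightarrow> mag J V (\<lambda>x. - f x) x = - mag J V f x"
  by (simp add: gibbs_flip spin_compl gibbs_minus)

lemma gibbs_odd:
  assumes "\<And>A. A \<subseteq> V \<Longrightarrow> g (V - A) = - g A"
  shows "gibbs J V (\<lambda>_. 0) g = 0"
proof -
  have "gibbs J V (\<lambda>_. 0) g = gibbs J V (\<lambda>_. 0) (\<lambda>A. g (V - A))"
    using gibbs_flip[of J V "\<lambda>_. 0" g] by simp
  also have "\<dots> = gibbs J V (\<lambda>_. 0) (\<lambda>A. - g A)"
    by (rule gibbs_cong_fun) (simp add: assms)
  finally show ?thesis by (simp add: gibbs_minus)
qed

lemma sum_Pow_insert:
  assumes "finite V" "w \<notin> V"
  shows "(\<Sum>A\<in>Pow (insert w V). F A) = (\<Sum>A\<in>Pow V. F (insert w A)) + (\<Sum>A\<in>Pow V. F A :: real)"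
proof -
  have "inj_on (insert w) (Pow V)"
    using assms(2) by (auto simp: inj_on_def) 
  moreover have "Pow V \<inter> insert w ` Pow V = {}"
    using assms(2) by auto
  ultimately show ?thesis
    using assms(1) by (simp add: Pow_insert sum.union_disjoint sum.reindex)
qed

section \<open>Splitting off one vertex\<close>

locale ferromagnet =
  fixes J :: "'a \<Rightarrow> 'a \<Rightarrow> real"
  assumes J_sym: "J x y = J y x" and J_nonneg: "0 \<le> J x y" and J_diag [simp]: "J x x = 0"
begin

lemma energy_insert:
  assumes "finite V" "w \<notin> V"
  shows "energy J (insert w V) f A =
    f w * spin A w + energy J V (\<lambda>x. f x + spin A w * J w x) A"
proof -
  have "(\<Sum>x\<in>V. J x w * (spin A x * spin A w)) = (\<Sum>y\<in>V. J w y * (spin A w * spin A y))"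
    by (intro sum.cong refl) (simp add: J_sym[of _ w])
  moreover have "(\<Sum>x\<in>V. (f x + spin A w * J w x) * spin A x) =
      (\<Sum>x\<in>V. f x * spin A x) + (\<Sum>y\<in>V. J w y * (spin A w * spin A y))"
    by (simp add: algebra_simps sum.distrib)
  ultimately show ?thesis
    using assms by (simp add: energy_def sum.distrib add_divide_distrib)
qed

lemma energy_cong:
  assumes "\<And>x. x \<in> V \<Longrightarrow> spin A x = spin B x"
  shows "energy J V f A = energy J V f B"
  unfolding energy_def using assms by (simp cong: sum.cong)

text \<open>A pinned spin at \<open>w\<close> acts on the other vertices as the field
  \<open>J w\<close> or \<open>- J w\<close>. Conditioning thus stays within Gibbs measures on
  smaller vertex sets, which makes induction on the vertex set possible.\<close>

lemma wsum_insert: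
  assumes "finite V" "w \<notin> V"
  shows "wsum J (insert w V) f g =
    exp (f w) * wsum J V (\<lambda>x. f x + J w x) (\<lambda>A. g (insert w A)) +
    exp (- f w) * wsum J V (\<lambda>x. f x - J w x) g"
proof -
  have *: "energy J V (\<lambda>x. f x + J w x) (insert w A) = energy J V (\<lambda>x. f x + J w x) A" for A
    using assms(2) by (intro energy_cong) (auto simp: spin_def)
  have "(\<Sum>A\<in>Pow V. exp (energy J (insert w V) f (insert w A)) * g (insert w A)) =
      exp (f w) * wsum J V (\<lambda>x. f x + J w x) (\<lambda>A. g (insert w A))"
    using assms by (simp add: energy_insert wsum_def spin_def[of _ w] exp_add sum_distrib_left
        mult.assoc *)
  moreover have "(\<Sum>A\<in>Pow V. exp (energy J (insert w V) f A) * g A) =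
      exp (- f w) * wsum J V (\<lambda>x. f x - J w x) g"
  proof -
    have "exp (energy J (insert w V) f A) * g A =
        exp (- f w) * (exp (energy J V (\<lambda>x. f x - J w x) A) * g A)" if "A \<in> Pow V" for A
    proof -
      have "spin A w = -1" using that assms(2) by (auto simp: spin_def)
      then show ?thesis using assms by (simp add: energy_insert exp_diff exp_minus field_simps)
    qed
    then show ?thesis unfolding wsum_def sum_distrib_left by (intro sum.cong refl)
  qed
  ultimately show ?thesis
    using assms by (simp add: wsum_def[of _ "insert w V"] sum_Pow_insert)
qed

text \<open>
  The odds of a plus spin at \<open>w \<notin> V\<close> in the measure on \<open>insert w V\<close>, without the factor
  \<open>exp (2 * f w)\<close> of the field at \<open>w\<close> itself.
\<close>

definition odds :: "'a set \<Rightarrow> ('a \<Rightarrow> real) \<Rightarrow> 'a \<Rightarrow> real" where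
  "odds V f w = pfun J V (\<lambda>x. f x + J w x) / pfun J V (\<lambda>x. f x - J w x)"

lemma odds_pos: "finite V \<Longrightarrow> 0 < odds V f w"
  by (simp add: odds_def pfun_pos)

lemma gibbs_insert:
  fixes f :: "'a \<Rightarrow> real"
  assumes "finite V" "w \<notin> V"
  defines "r \<equiv> exp (2 * f w) * odds V f w"
  shows "gibbs J (insert w V) f g =
    r / (1 + r) * gibbs J V (\<lambda>x. f x + J w x) (\<lambda>A. g (insert w A)) +
    1 / (1 + r) * gibbs J V (\<lambda>x. f x - J w x) g"
proof -
  define E where "E = exp (f w)"
  define P where "P = pfun J V (\<lambda>x. f x + J w x)"
  define M where "M = pfun J V (\<lambda>x. f x - J w x)"
  have pos: "E > 0" "P > 0" "M > 0"
    using assms(1) by (auto simp: E_def P_def M_def pfun_pos)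
  have r: "r = E * E * P / M"
    by (simp add: r_def odds_def E_def P_def M_def flip: exp_add)
  have E: "exp (- f w) = 1 / E"
    by (simp add: E_def exp_minus field_simps)
  have "E * P + M / E > 0" "1 + r > 0" using pos by (auto simp: r add_pos_pos)
  then show ?thesis
    unfolding gibbs_def wsum_insert[OF assms(1,2)] E E_def[symmetric] P_def[symmetric] M_def[symmetric]
    unfolding r using pos
    by (simp add: divide_simps) (simp add: algebra_simps)
qed

lemma mag_insert_self:
  fixes f :: "'a \<Rightarrow> real"
  assumes "finite V" "w \<notin> V"
  defines "r \<equiv> exp (2 * f w) * odds V f w"
  shows "mag J (insert w V) f w = (r - 1) / (1 + r)"
proof -
  have "gibbs J V (\<lambda>x. f x - J w x) (\<lambda>A. spin A w) = gibbs J V (\<lambda>x. f x - J w x) (\<lambda>A. - 1)"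
    using assms(2) by (intro gibbs_cong_fun) (auto simp: spin_def)
  then show ?thesis
    using assms(1) by (simp add: gibbs_insert[OF assms(1,2)] r_def gibbs_const spin_def[of "insert w _"]
        gibbs_minus diff_divide_distrib)
qed

end

section \<open>Monotonicity in the field\<close>

lemma energy_add_field:
  "energy J V (\<lambda>x. f x + k x) A = energy J V f A + (\<Sum>x\<in>V. k x * spin A x)"
  by (simp add: energy_def algebra_simps sum.distrib)

context ferromagnet
begin

text \<open>The probability of a plus spin at \<open>w\<close> in the measure on
  \<open>insert w V\<close>.\<close>

definition up :: "'a set \<Rightarrow> ('a \<Rightarrow> real) \<Rightarrow> 'a \<Rightarrow> real" where
  "up V f w = exp (2 * f w) * odds V f w / (1 + exp (2 * f w) * odds V f w)"

lemma up_bounds: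
  assumes "finite V" shows "0 < up V f w" "up V f w < 1"
  using odds_pos[OF assms, of f w] by (simp_all add: up_def add_pos_pos)

lemma gibbs_split:
  assumes "finite V" "w \<notin> V"
  shows "gibbs J (insert w V) f g =
    up V f w * gibbs J V (\<lambda>x. f x + J w x) (\<lambda>A. g (insert w A)) +
    (1 - up V f w) * gibbs J V (\<lambda>x. f x - J w x) g"
proof -
  have "1 + exp (2 * f w) * odds V f w \<noteq> 0"
    using odds_pos[OF assms(1), of f w] by (smt (verit) exp_gt_zero mult_pos_pos)
  then show ?thesis
    by (simp add: gibbs_insert[OF assms] up_def divide_simps)
qed

lemma mag_split_self:
  assumes "finite V" "w \<notin> V"
  shows "mag J (insert w V) f w = 2 * up V f w - 1"
proof -
  have "1 + exp (2 * f w) * odds V f w > 0"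
    using odds_pos[OF assms(1), of f w] by (simp add: add_pos_pos)
  then show ?thesis
    by (simp add: mag_insert_self[OF assms] up_def divide_simps)
qed

text \<open>Passing from the field \<open>f - J w\<close> to \<open>f + J w\<close> tilts the
  measure by an increasing function of the spins. The odds are therefore the mean of an increasing
  function on the smaller set, and FKG on that set compares them for different fields.\<close>

lemma odds_eq_gibbs:
  "odds V f w = gibbs J V (\<lambda>x. f x - J w x) (\<lambda>A. exp (2 * (\<Sum>x\<in>V. J w x * spin A x)))"
proof -
  have "energy J V (\<lambda>x. f x + J w x) A =
      energy J V (\<lambda>x. f x - J w x) A + 2 * (\<Sum>x\<in>V. J w x * spin A x)" for A
  proof -
    have "(\<lambda>x. f x + J w x) = (\<lambda>x. f x - J w x + 2 * J w x)" by auto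
    then show ?thesis
      by (simp only: energy_add_field) (simp add: sum_distrib_left mult.assoc)
  qed
  then show ?thesis
    by (simp add: odds_def gibbs_def wsum_def exp_add)
qed

lemma gibbs_insert_mono:
  assumes "finite V" "w \<notin> V"
    and "\<And>A. A \<subseteq> V \<Longrightarrow> g A \<le> g (insert w A)"
  shows "gibbs J V f g \<le> gibbs J V f (\<lambda>A. g (insert w A))"
  using assms by (intro gibbs_mono) auto

text \<open>Induction on \<open>V\<close> with the function and both fields arbitrary. Both
  conditional means given the spin at \<open>w\<close> increase with the field, and so does the
  probability of a plus spin; the mean given plus dominates the mean given minus, so shifting weight
  to plus increases the total.\<close>

lemma fkg:
  assumes "finite V"
    and "\<And>A B. A \<subseteq> B \<Longrightarrow> B \<subseteq> V \<Longrightarrow> g A \<le> g B"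
    and "\<And>x. x \<in> V \<Longrightarrow> f x \<le> f' x"
  shows "gibbs J V f g \<le> gibbs J V f' g"
  using assms
proof (induction V arbitrary: f f' g rule: finite_induct)
  case empty
  then show ?case by (simp add: gibbs_def wsum_def energy_def)
next
  case (insert w V)
  define E1 where "E1 = gibbs J V (\<lambda>x. f x + J w x) (\<lambda>A. g (insert w A))"
  define E0 where "E0 = gibbs J V (\<lambda>x. f x - J w x) g"
  define F1 where "F1 = gibbs J V (\<lambda>x. f' x + J w x) (\<lambda>A. g (insert w A))"
  define F0 where "F0 = gibbs J V (\<lambda>x. f' x - J w x) g"
  have mono: "g A \<le> g B" if "A \<subseteq> B" "B \<subseteq> V" for A B
    by (rule insert.prems(1)) (use that in auto)
  have mono': "g (insert w A) \<le> g (insert w B)" if "A \<subseteq> B" "B \<subseteq> V" for A B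
    by (rule insert.prems(1)) (use that in auto)
  have "E1 \<le> F1"
    unfolding E1_def F1_def by (rule insert.IH) (use insert.prems(2) mono' in auto)
  moreover have "E0 \<le> F0"
    unfolding E0_def F0_def by (rule insert.IH) (use insert.prems(2) mono in auto)
  moreover have "F0 \<le> F1"
  proof -
    have "F0 \<le> gibbs J V (\<lambda>x. f' x + J w x) g"
      unfolding F0_def
      by (rule insert.IH) (use mono J_nonneg in \<open>auto simp: add_increasing2 intro: order_trans[of _ "f' _"]\<close>)
    also have "\<dots> \<le> F1"
      unfolding F1_def
      by (rule gibbs_insert_mono) (use insert.hyps in \<open>auto intro!: insert.prems(1)\<close>)
    finally show ?thesis .
  qed
  moreover have "up V f w \<le> up V f' w"
  proof -
    have "odds V f w \<le> odds V f' w"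
    proof -
      have "odds V f w \<le> gibbs J V (\<lambda>x. f' x - J w x)
          (\<lambda>A. exp (2 * (\<Sum>x\<in>V. J w x * spin A x)))"
        unfolding odds_eq_gibbs
        by (rule insert.IH)
          (use insert.prems(2) in \<open>auto intro!: sum_mono mult_left_mono J_nonneg spin_mono\<close>)
      then show ?thesis by (simp add: odds_eq_gibbs)
    qed
    moreover have "exp (2 * f w) \<le> exp (2 * f' w)" using insert.prems(2) by simp
    ultimately have "exp (2 * f w) * odds V f w \<le> exp (2 * f' w) * odds V f' w"
      using odds_pos[OF insert.hyps(1), of f w] by (intro mult_mono) auto
    moreover have "a / (1 + a) \<le> b / (1 + b)" if "0 \<le> a" "a \<le> b" for a b :: real
      using that by (simp add: divide_simps) (simp add: algebra_simps)
    ultimately show ?thesis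
      using odds_pos[OF insert.hyps(1), of f w] by (simp add: up_def)
  qed
  moreover have "up V f w * E1 + (1 - up V f w) * E0 \<le> up V f w * F1 + (1 - up V f w) * F0"
    using calculation up_bounds[OF insert.hyps(1), of f w]
    by (intro add_mono mult_left_mono) auto
  moreover have "up V f w * F1 + (1 - up V f w) * F0 \<le> up V f' w * F1 + (1 - up V f' w) * F0"
  proof -
    have "up V f w * (F1 - F0) \<le> up V f' w * (F1 - F0)"
      using calculation by (intro mult_right_mono) auto
    then show ?thesis by (simp add: algebra_simps)
  qed
  ultimately show ?case
    using insert.hyps by (simp add: gibbs_split E1_def E0_def F1_def F0_def)
qed

text \<open>The covariance with a two-valued variable is a multiple of the difference of the two
  conditional means; the factor is half the variance of the spin.\<close>

lemma gcov_split:
  assumes "finite V" "w \<notin> V"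
  shows "gcov J (insert w V) f (\<lambda>A. spin A w) g = 2 * up V f w * (1 - up V f w) *
    (gibbs J V (\<lambda>x. f x + J w x) (\<lambda>A. g (insert w A)) - gibbs J V (\<lambda>x. f x - J w x) g)"
proof -
  have "gibbs J V (\<lambda>x. f x - J w x) (\<lambda>A. spin A w * g A) = - gibbs J V (\<lambda>x. f x - J w x) g"
    unfolding gibbs_minus[symmetric] using assms(2) by (intro gibbs_cong_fun) (auto simp: spin_def)
  moreover have "spin (insert w A) w = 1" for A by (simp add: spin_def)
  ultimately have 1: "gibbs J (insert w V) f (\<lambda>A. spin A w * g A) =
     up V f w * gibbs J V (\<lambda>x. f x + J w x) (\<lambda>A. g (insert w A)) -
     (1 - up V f w) * gibbs J V (\<lambda>x. f x - J w x) g"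
    by (simp add: gibbs_split[OF assms])
  show ?thesis
    unfolding gcov_def 1 mag_split_self[OF assms] gibbs_split[OF assms, of f g]
    by (simp add: algebra_simps)
qed

lemma gcov_nonneg:
  assumes "finite V" "x \<in> V" and mono: "\<And>A B. A \<subseteq> B \<Longrightarrow> B \<subseteq> V \<Longrightarrow> g A \<le> g B"
  shows "0 \<le> gcov J V f (\<lambda>A. spin A x) g"
proof -
  define W where "W = V - {x}"
  have V: "V = insert x W" "finite W" "x \<notin> W" using assms by (auto simp: W_def)
  have "gibbs J W (\<lambda>y. f y - J x y) g \<le> gibbs J W (\<lambda>y. f y + J x y) g"
    by (rule fkg) (use V J_nonneg in \<open>auto intro: order_trans[of _ "f _"] intro!: mono\<close>)
  also have "\<dots> \<le> gibbs J W (\<lambda>y. f y + J x y) (\<lambda>A. g (insert x A))"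
    by (rule gibbs_insert_mono) (use V mono in \<open>auto intro!: mono\<close>)
  finally show ?thesis
    unfolding V(1) gcov_split[OF V(2,3)]
    using up_bounds[OF V(2), of f x] by (intro mult_nonneg_nonneg) auto
qed

lemma mag_mono: "finite V \<Longrightarrow> (\<And>y. y \<in> V \<Longrightarrow> f y \<le> f' y) \<Longrightarrow> mag J V f x \<le> mag J V f' x"
  by (rule fkg) (auto simp: spin_mono)

section \<open>Zero field and two-point functions\<close>

lemma mag_zero_field: "x \<in> V \<Longrightarrow> mag J V (\<lambda>_. 0) x = 0"
  by (rule gibbs_odd) (simp add: spin_compl)

lemma mag_nonneg:
  assumes "finite V" "x \<in> V" "\<And>y. y \<in> V \<Longrightarrow> 0 \<le> f y"
  shows "0 \<le> mag J V f x"
  using mag_mono[of V "\<lambda>_. 0" f x] assms by (simp add: mag_zero_field)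

lemma odds_zero_field: "finite V \<Longrightarrow> odds V (\<lambda>_. 0) w = 1"
  using pfun_flip[of J V "J w"] pfun_pos[of V J "J w"] by (simp add: odds_def)

text \<open>In zero field the two values at \<open>w\<close> are equally likely and the global flip
  exchanges them. For an even function both conditional means agree, so \<open>w\<close> can be
  pinned to plus.\<close>

lemma gibbs_even:
  assumes "finite V" "w \<notin> V" and even: "\<And>A. A \<subseteq> insert w V \<Longrightarrow> g (insert w V - A) = g A"
  shows "gibbs J (insert w V) (\<lambda>_. 0) g = gibbs J V (J w) (\<lambda>A. g (insert w A))"
proof -
  have "gibbs J V (\<lambda>x. - J w x) g = gibbs J V (J w) (\<lambda>A. g (insert w A))"
    unfolding gibbs_flip
  proof (rule gibbs_cong_fun)
    fix A assume "A \<subseteq> V"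
    then have "V - A = insert w V - insert w A" using assms(2) by auto
    then show "g (V - A) = g (insert w A)" using even[of "insert w A"] \<open>A \<subseteq> V\<close> by auto
  qed
  then show ?thesis
    by (simp add: gibbs_split[OF assms(1,2)] up_def odds_zero_field[OF assms(1)])
qed

text \<open>This turns zero-field two-point functions into magnetizations in the nonnegative field
  \<open>J w\<close>, to which the FKG inequality applies.\<close>

lemma corr_insert:
  assumes "finite V" "w \<notin> V" "x \<in> V"
  shows "corr J (insert w V) w x = mag J V (J w) x"
proof -
  have "corr J (insert w V) w x = gibbs J V (J w) (\<lambda>A. spin (insert w A) w * spin (insert w A) x)"
    using assms by (intro gibbs_even) (auto simp: spin_compl)
  moreover have "spin (insert w A) x = spin A x" for A
    using assms by (auto simp: spin_def)
  ultimately show ?thesis by (simp add: spin_def[of "insert w _" w])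
qed

lemma corr_nonneg:
  assumes "finite V" "x \<in> V" "y \<in> V"
  shows "0 \<le> corr J V x y"
proof (cases "x = y")
  case True
  then show ?thesis using assms by (simp add: gibbs_const)
next
  case False
  then have "corr J V x y = mag J (V - {x}) (J x) y"
    using corr_insert[of "V - {x}" x y] assms by (simp add: insert_absorb)
  then show ?thesis
    using mag_nonneg[of "V - {x}" y "J x"] assms False J_nonneg by auto
qed

lemma corr_commute: "corr J V x y = corr J V y x"
  by (simp add: mult.commute)

text \<open>After pinning \<open>x\<close> to plus, the difference of the two sides is the
  covariance of the spins at \<open>y\<close> and \<open>z\<close> in the field \<open>J x\<close>,
  which is nonnegative by FKG.\<close>

lemma corr_mult_le:
  assumes "finite V" "x \<in> V" "y \<in> V" "z \<in> V"
  shows "corr J V x y * corr J V x z \<le> corr J V y z"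
proof -
  consider "x = y" | "x = z" | "x \<noteq> y" "x \<noteq> z" by blast
  then show ?thesis
  proof cases
    case 3
    define W where "W = V - {x}"
    have V: "V = insert x W" "finite W" "x \<notin> W" "y \<in> W" "z \<in> W"
      using assms 3 by (auto simp: W_def)
    have "corr J V y z = gibbs J W (J x) (\<lambda>A. spin (insert x A) y * spin (insert x A) z)"
      unfolding V(1) using V by (intro gibbs_even) (auto simp: spin_compl)
    also have "\<dots> = gibbs J W (J x) (\<lambda>A. spin A y * spin A z)"
      using 3 by (simp add: spin_def)
    finally have "corr J V y z - corr J V x y * corr J V x z =
        gcov J W (J x) (\<lambda>A. spin A y) (\<lambda>A. spin A z)"
      using corr_insert[OF V(2,3)] V by (simp add: gcov_def)
    moreover have "0 \<le> gcov J W (J x) (\<lambda>A. spin A y) (\<lambda>A. spin A z)"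
      using V by (intro gcov_nonneg) (auto simp: spin_mono)
    ultimately show ?thesis by linarith
  qed (use assms in \<open>auto simp: gibbs_const corr_commute\<close>)
qed

end

section \<open>The influence of the field on boundary effects\<close>

text \<open>
  The induction step of the Ding-Song-Sun inequality. Here \<open>x\<close> and \<open>1 / y\<close> are the odds of a plus
  spin at \<open>w\<close> in the fields \<open>h + a\<close> and \<open>h - a\<close>, \<open>k = exp (2 * a w)\<close>, and \<open>z\<close> is the odds in the field
  \<open>a\<close> with \<open>a w\<close> deleted. A different weight for each of \<open>x\<close> and \<open>y\<close> would not do: the point is that a
  single \<open>s\<close> writes the influence as a mixture of the contracted one and a deleted one, at the cost of
  another value of \<open>h w\<close>.
\<close>

lemma odds_interpolation:
  fixes x y z r k e A B X Y :: real
  assumes pos: "0 < x" "0 < y" "0 < r" "1 \<le> k" and xy: "x * y = (k * r)\<^sup>2" and rz: "r \<le> z"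
    and con: "e + A + B \<le> X"
    and del: "\<And>x' y'. 0 < x' \<Longrightarrow> 0 < y' \<Longrightarrow> x' * y' = r\<^sup>2 \<Longrightarrow>
      e + A * (x' / (1 + x')) + B * (y' / (1 + y')) \<le> Y"
    and YX: "Y \<le> X"
  shows "e + A * (x / (1 + x)) + B * (y / (1 + y)) \<le> X - (1 + z) / (1 + k * z) * (X - Y)"
proof -
  \<comment> \<open>\<open>F s\<close> is the product of the odds \<open>x'\<close> and
    \<open>y'\<close> whose minus probabilities, multiplied by \<open>s\<close>, are those of
    \<open>x\<close> and \<open>y\<close>; \<open>l\<close> is the least \<open>s\<close> for which
    both are nonnegative. As \<open>F l = 0\<close> and \<open>F 1 = (k * r)\<^sup>2\<close>, some
    \<open>s\<close> gives the product \<open>r\<^sup>2\<close> that \<open>del\<close> asks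
    for.\<close>
  define F where "F s = (s * (1 + x) - 1) * (s * (1 + y) - 1)" for s
  define l where "l = max (1 / (1 + x)) (1 / (1 + y))"
  have l: "l \<le> 1" using pos by (simp add: l_def)
  have "F l = 0" using pos by (auto simp: F_def l_def max_def)
  moreover have "r\<^sup>2 \<le> F 1"
    using pos mult_right_mono[of 1 k r] by (simp add: F_def xy power_mono)
  moreover have "continuous_on {l..1} F" unfolding F_def by (intro continuous_intros)
  ultimately obtain s where s: "l \<le> s" "s \<le> 1" "F s = r\<^sup>2"
    using IVT'[of F l "r\<^sup>2" 1] l by auto
  define x' where "x' = s * (1 + x) - 1"
  define y' where "y' = s * (1 + y) - 1"
  have sx: "1 / (1 + x) \<le> s" "1 / (1 + y) \<le> s" using s(1) by (auto simp: l_def)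
  have "0 \<le> x'" "0 \<le> y'"
    using sx pos by (simp_all add: x'_def y'_def divide_le_eq)
  moreover have x'y': "x' * y' = r\<^sup>2" using s(3) by (simp add: F_def x'_def y'_def)
  moreover have "r\<^sup>2 \<noteq> 0" using pos by simp
  ultimately have xy'_pos: "0 < x'" "0 < y'" by (metis less_eq_real_def mult_zero_left mult_zero_right)+
  have frac: "1 - u / (1 + u) = s * (1 - u' / (1 + u'))"
    if "0 < u" "0 < u'" "u' = s * (1 + u) - 1" for u u'
  proof -
    have "1 + u' = s * (1 + u)" using that by simp
    moreover have "s * (1 + u) \<noteq> 0" using that by (metis add.right_neutral diff_gt_0_iff_gt less_irrefl mult_zero_left not_one_less_zero)
    moreover have "1 - u / (1 + u) = 1 / (1 + u)" "1 - u' / (1 + u') = 1 / (1 + u')"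
      using that(1,2) by (simp_all add: field_simps)
    ultimately show ?thesis by simp
  qed
  have "e + A * (x / (1 + x)) + B * (y / (1 + y)) =
      (e + A + B) - A * (1 - x / (1 + x)) - B * (1 - y / (1 + y))"
    by (simp add: algebra_simps)
  also have "\<dots> = (1 - s) * (e + A + B) + s * (e + A * (x' / (1 + x')) + B * (y' / (1 + y')))"
    unfolding frac[OF pos(1) xy'_pos(1) x'_def] frac[OF pos(2) xy'_pos(2) y'_def]
    by (simp add: algebra_simps)
  also have "\<dots> \<le> (1 - s) * X + s * Y"
  proof -
    have "0 < s" using sx(1) pos(1) by (smt (verit) divide_pos_pos)
    then show ?thesis
      using s(2) con del[OF xy'_pos x'y'] by (intro add_mono mult_left_mono) auto
  qed
  also have "\<dots> = X - s * (X - Y)" by (simp add: algebra_simps)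
  \<comment> \<open>It remains to bound \<open>s\<close> from below by its value
    \<open>(1 + r) / (1 + k * r)\<close> in the symmetric case \<open>x = y = k * r\<close>. This
    value decreases in \<open>r\<close>, and \<open>r \<le> z\<close>.\<close>
  also have "\<dots> \<le> X - (1 + z) / (1 + k * z) * (X - Y)"
  proof -
    have "(1 + z) / (1 + k * z) \<le> (1 + r) / (1 + k * r)"
    proof -
      have "(k - 1) * r \<le> (k - 1) * z" using pos rz by (intro mult_left_mono) auto
      then have "(1 + z) * (1 + k * r) \<le> (1 + r) * (1 + k * z)" by (simp add: algebra_simps)
      moreover have "0 < 1 + k * z" "0 < 1 + k * r"
        using pos rz by (auto intro!: add_pos_pos mult_pos_pos)
      ultimately show ?thesis by (simp add: divide_simps)
    qed
    also have "\<dots> \<le> s"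
    proof (rule ccontr)
      assume "\<not> (1 + r) / (1 + k * r) \<le> s"
      then have small: "s * (1 + k * r) - 1 < r"
        using pos by (simp add: not_le less_divide_eq add_pos_pos)
      have kr: "0 < k * r" using pos by auto
      \<comment> \<open>This makes the left side of \<open>small\<close> nonnegative, so that it can
        be squared.\<close>
      have "min x y \<le> k * r"
      proof (rule ccontr)
        assume "\<not> min x y \<le> k * r"
        then have "(k * r) * (k * r) < x * y" using kr by (intro mult_strict_mono) auto
        then show False by (simp add: xy power2_eq_square)
      qed
      then have "0 \<le> s * (1 + k * r) - 1"
      proof -
        have "1 \<le> s * (1 + min x y)"
          using \<open>0 \<le> x'\<close> \<open>0 \<le> y'\<close> by (auto simp: x'_def y'_def min_def)
        also have "\<dots> \<le> s * (1 + k * r)"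
          using \<open>min x y \<le> k * r\<close> sx(1) pos(1)
          by (intro mult_left_mono) (auto intro: order_trans[of _ "1 / (1 + x)"])
        finally show ?thesis by simp
      qed
      then have "(s * (1 + k * r) - 1)\<^sup>2 < r\<^sup>2"
        using small pos(3) by (intro power_strict_mono) auto
      \<comment> \<open>By the AM-GM inequality the symmetric case minimizes \<open>x + y\<close>
        for the given product, hence maximizes \<open>F s\<close> for \<open>s\<close> between 0 and
        1.\<close>
      moreover have "2 * (k * r) \<le> x + y"
      proof -
        have "(2 * (k * r))\<^sup>2 \<le> (x + y)\<^sup>2"
          using xy sum_squares_ge_zero[of "x - y" 0] by (simp add: power2_eq_square algebra_simps)
        then show ?thesis by (rule power2_le_imp_le) (use pos in simp)
      qed
      then have "0 \<le> s * (1 - s) * (x + y - 2 * (k * r))"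
        using s(2) sx(1) pos(1) by (intro mult_nonneg_nonneg) (auto intro: order_trans[of _ "1 / (1 + x)"])
      moreover have "F s = s\<^sup>2 * (1 + (x + y) + x * y) - s * (2 + (x + y)) + 1"
        by (simp add: F_def power2_eq_square algebra_simps)
      then have "F s = (s * (1 + k * r) - 1)\<^sup>2 - s * (1 - s) * (x + y - 2 * (k * r))"
        unfolding xy by (simp add: power2_eq_square algebra_simps)
      ultimately show False using s(3) by linarith
    qed
    finally have "(1 + z) / (1 + k * z) * (X - Y) \<le> s * (X - Y)"
      using YX by (intro mult_right_mono) auto
    then show ?thesis by simp
  qed
  finally show ?thesis .
qed

context ferromagnet
begin

lemma odds_cong: "(\<And>x. x \<in> V \<Longrightarrow> f x = f' x) \<Longrightarrow> odds V f w = odds V f' w"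
  unfolding odds_def by (intro arg_cong2[of _ _ _ _ "(/)"] wsum_cong) auto

lemma odds_flip: "odds V (\<lambda>x. - f x) w = 1 / odds V f w"
proof -
  have "pfun J V (\<lambda>x. - f x + J w x) = pfun J V (\<lambda>x. f x - J w x)"
       "pfun J V (\<lambda>x. - f x - J w x) = pfun J V (\<lambda>x. f x + J w x)"
    using pfun_flip[of J V "\<lambda>x. f x - J w x"] pfun_flip[of J V "\<lambda>x. f x + J w x"]
    by (simp_all add: algebra_simps)
  then show ?thesis by (simp add: odds_def)
qed

text \<open>\<open>y\<close> is the odds of a minus spin at \<open>w\<close> in the field
  \<open>f'\<close>, while \<open>x\<close> is the odds of a plus spin in \<open>f\<close>. When
  both tend to infinity, \<open>w\<close> is pinned to plus in one measure and to minus in the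
  other, which is the contracted case.\<close>

lemma gibbs_diff_split:
  assumes "finite W" "w \<notin> W" and x: "x = exp (2 * f w) * odds W f w"
    and y: "y * (exp (2 * f' w) * odds W f' w) = 1"
  shows "gibbs J (insert w W) f g - gibbs J (insert w W) f' g =
    (gibbs J W (\<lambda>u. f u - J w u) g - gibbs J W (\<lambda>u. f' u + J w u) (\<lambda>A. g (insert w A))) +
    (gibbs J W (\<lambda>u. f u + J w u) (\<lambda>A. g (insert w A)) - gibbs J W (\<lambda>u. f u - J w u) g) *
      (x / (1 + x)) +
    (gibbs J W (\<lambda>u. f' u + J w u) (\<lambda>A. g (insert w A)) - gibbs J W (\<lambda>u. f' u - J w u) g) *
      (y / (1 + y))"
proof -
  define u where "u = exp (2 * f' w) * odds W f' w"
  have "0 < u" using odds_pos[OF assms(1)] by (simp add: u_def)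
  moreover have "y = 1 / u" using y \<open>0 < u\<close> unfolding u_def[symmetric] by (simp add: field_simps)
  ultimately have "1 - up W f' w = y / (1 + y)"
    by (simp add: up_def flip: u_def) (simp add: divide_simps)
  moreover define q where "q = y / (1 + y)"
  ultimately have up_q: "up W f' w = 1 - q" by simp
  define p where "p = x / (1 + x)"
  have up_p: "up W f w = p" by (simp add: up_def x p_def)
  show ?thesis
    unfolding gibbs_split[OF assms(1,2)] up_p up_q p_def[symmetric] q_def[symmetric]
    by (simp add: algebra_simps)
qed

text \<open>The outer induction shrinks \<open>V\<close>, for contraction; the inner one removes
  \<open>a\<close> at one vertex \<open>w\<close>, for deletion. The field \<open>h\<close> stays
  arbitrary because deletion is applied with another value of \<open>h w\<close>.\<close>

lemma influence_le_zero_field: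
  assumes "finite V" "\<And>x. x \<in> V \<Longrightarrow> 0 \<le> a x" "v \<in> V"
  shows "mag J V (\<lambda>x. h x + a x) v - mag J V (\<lambda>x. h x - a x) v \<le> 2 * mag J V a v"
  using assms
proof (induction V arbitrary: a h v rule: finite_psubset_induct)
  case (psubset V)
  note IH_con = psubset.IH
  from psubset.prems show ?case
  proof (induction "card {x \<in> V. a x \<noteq> 0}" arbitrary: a h v rule: less_induct)
    case less
    note IH_del = less.hyps
    show ?case
    proof (cases "\<forall>x\<in>V. a x = 0")
      case True
      have "mag J V (\<lambda>x. h x + a x) v = mag J V h v" "mag J V (\<lambda>x. h x - a x) v = mag J V h v"
        "mag J V a v = mag J V (\<lambda>_. 0) v"
        by (rule gibbs_cong_field; simp add: True)+
      then show ?thesis using less.prems by (simp add: mag_zero_field)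
    next
      case False
      then obtain w where w: "w \<in> V" "a w \<noteq> 0" by blast
      define W where "W = V - {w}"
      have V: "V = insert w W" "finite W" "w \<notin> W" "W \<subset> V"
        using w psubset.hyps by (auto simp: W_def)
      define a0 where "a0 = a(w := 0)"
      define k where "k = exp (2 * a w)"
      have k: "1 \<le> k" using less.prems(1)[OF w(1)] by (simp add: k_def)
      have a0_W: "a0 u = a u" if "u \<in> W" for u using that V by (auto simp: a0_def)
      define G1 where "G1 f v = gibbs J W (\<lambda>u. f u + J w u) (\<lambda>A. spin (insert w A) v)" for f v
      define G0 where "G0 f v = gibbs J W (\<lambda>u. f u - J w u) (\<lambda>A. spin A v)" for f v
      have G_cong: "G1 f v = G1 f' v" "G0 f v = G0 f' v" if "\<And>u. u \<in> W \<Longrightarrow> f u = f' u" for f f' v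
        unfolding G1_def G0_def using that by (auto intro!: gibbs_cong_field)
      have G_w: "G1 f w = 1" "G0 f w = -1" for f
      proof -
        have "gibbs J W (\<lambda>u. f u - J w u) (\<lambda>A. spin A w) = gibbs J W (\<lambda>u. f u - J w u) (\<lambda>A. - 1)"
          using V(3) by (intro gibbs_cong_fun) (auto simp: spin_def)
        then show "G1 f w = 1" "G0 f w = -1"
          using V(2) by (simp_all add: G1_def G0_def spin_def[of "insert w _"] gibbs_const)
      qed
      have G_v: "G1 f v = mag J W (\<lambda>u. f u + J w u) v" "G0 f v = mag J W (\<lambda>u. f u - J w u) v"
        if "v \<noteq> w" for f v
        unfolding G1_def G0_def using that by (simp_all add: spin_def)
      have G_le: "G0 f v \<le> G1 f v" for f v
      proof -
        have "G0 f v \<le> mag J W (\<lambda>u. f u + J w u) v"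
          unfolding G0_def using J_nonneg[of w]
          by (intro mag_mono V(2)) (auto intro: order_trans[of _ "f _"])
        also have "\<dots> \<le> G1 f v"
          unfolding G1_def using V by (intro gibbs_insert_mono) (auto simp: spin_mono subset_insertI)
        finally show ?thesis .
      qed
      define o1 where "o1 f = odds W f w" for f
      have o1_pos: "0 < o1 f" for f using odds_pos[OF V(2)] by (simp add: o1_def)
      have o1_cong: "o1 f = o1 f'" if "\<And>u. u \<in> W \<Longrightarrow> f u = f' u" for f f'
        unfolding o1_def by (rule odds_cong) (rule that)
      \<comment> \<open>The influence depends on the fields at \<open>w\<close> only through the
        odds \<open>x\<close> and \<open>y\<close>. The coefficients \<open>e\<close>,
        \<open>AA\<close> and \<open>BB\<close> are determined by the fields off \<open>w\<close>,
        so the original, the deleted and the contracted problem share them.\<close>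
      define e where "e h v = G0 (\<lambda>u. h u + a u) v - G1 (\<lambda>u. h u - a u) v" for h v
      define AA where "AA h v = G1 (\<lambda>u. h u + a u) v - G0 (\<lambda>u. h u + a u) v" for h v
      define BB where "BB h v = G1 (\<lambda>u. h u - a u) v - G0 (\<lambda>u. h u - a u) v" for h v
      have pair: "mag J V f v - mag J V f' v =
          e h v + AA h v * (x / (1 + x)) + BB h v * (y / (1 + y))"
        if "\<And>u. u \<in> W \<Longrightarrow> f u = h u + a u" "\<And>u. u \<in> W \<Longrightarrow> f' u = h u - a u"
          "x = exp (2 * f w) * o1 (\<lambda>u. h u + a u)"
          "y * (exp (2 * f' w) * o1 (\<lambda>u. h u - a u)) = 1" for f f' h v x y
      proof -
        have "o1 f = o1 (\<lambda>u. h u + a u)" "o1 f' = o1 (\<lambda>u. h u - a u)"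
          by (rule o1_cong, simp add: that)+
        then have "x = exp (2 * f w) * odds W f w" "y * (exp (2 * f' w) * odds W f' w) = 1"
          using that(3,4) by (simp_all add: o1_def)
        from gibbs_diff_split[OF V(2,3) this, of "\<lambda>A. spin A v"]
        show ?thesis
          unfolding V(1)[symmetric] G1_def[symmetric] G0_def[symmetric] e_def AA_def BB_def
          using G_cong[of f "\<lambda>u. h u + a u" v] G_cong[of f' "\<lambda>u. h u - a u" v] that(1,2) by simp
      qed
      \<comment> \<open>For \<open>h = 0\<close> both odds equal \<open>k * z\<close>, and both
        equal \<open>z\<close> once \<open>a w\<close> is deleted.\<close>
      define z where "z = o1 a"
      have z: "0 < z" by (simp add: z_def o1_pos)
      have o1_minus: "o1 (\<lambda>u. - a u) = 1 / z" by (simp add: o1_def odds_flip z_def)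
      have zero_a: "2 * mag J V a v = e (\<lambda>_. 0) v + AA (\<lambda>_. 0) v * (k * z / (1 + k * z)) +
          BB (\<lambda>_. 0) v * (k * z / (1 + k * z))" if "v \<in> V" for v
        using pair[of a "\<lambda>_. 0" "\<lambda>u. - a u" "k * z" "k * z" v] mag_flip[OF that, of J a] z
        by (simp add: o1_minus k_def z_def[symmetric] flip: exp_add)
      have zero_a0: "2 * mag J V a0 v = e (\<lambda>_. 0) v + AA (\<lambda>_. 0) v * (z / (1 + z)) +
          BB (\<lambda>_. 0) v * (z / (1 + z))" if "v \<in> V" for v
        using pair[of a0 "\<lambda>_. 0" "\<lambda>u. - a0 u" z z v] mag_flip[OF that, of J a0] z
        by (simp add: o1_minus z_def[symmetric] a0_W) (simp add: a0_def)
      define r where "r = sqrt (o1 (\<lambda>u. h u + a u) / o1 (\<lambda>u. h u - a u))"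
      have r: "0 < r" "r\<^sup>2 = o1 (\<lambda>u. h u + a u) / o1 (\<lambda>u. h u - a u)"
        using o1_pos by (simp_all add: r_def less_imp_le)
      have card_less: "card {x \<in> V. a0 x \<noteq> 0} < card {x \<in> V. a x \<noteq> 0}"
        using w psubset.hyps by (intro psubset_card_mono) (auto simp: a0_def)
      \<comment> \<open>With \<open>a w\<close> deleted, changing \<open>h w\<close> multiplies
        \<open>x'\<close> and divides \<open>y'\<close> by the same factor. Every positive pair with
        product \<open>r\<^sup>2\<close> is thus realized by a suitable value \<open>t\<close>, and
        the inner induction hypothesis covers it.\<close>
      have del: "e h v + AA h v * (x' / (1 + x')) + BB h v * (y' / (1 + y')) \<le> 2 * mag J V a0 v"
        if v: "v \<in> V" and "0 < x'" "0 < y'" "x' * y' = r\<^sup>2" for v x' y'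
      proof -
        define t where "t = ln (x' / o1 (\<lambda>u. h u + a u)) / 2"
        have t: "exp (2 * t) = x' / o1 (\<lambda>u. h u + a u)"
          using that o1_pos[of "\<lambda>u. h u + a u"] by (simp add: t_def)
        define h' where "h' = h(w := t)"
        have "mag J V (\<lambda>x. h' x + a0 x) v - mag J V (\<lambda>x. h' x - a0 x) v =
           e h v + AA h v * (x' / (1 + x')) + BB h v * (y' / (1 + y'))"
        proof (rule pair)
          show "h' u + a0 u = h u + a u" "h' u - a0 u = h u - a u" if "u \<in> W" for u
            using that V(3) by (auto simp: h'_def a0_def)
          show "x' = exp (2 * (h' w + a0 w)) * o1 (\<lambda>u. h u + a u)"
            using o1_pos[of "\<lambda>u. h u + a u"] by (simp add: h'_def a0_def t)
          show "y' * (exp (2 * (h' w - a0 w)) * o1 (\<lambda>u. h u - a u)) = 1"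
          proof -
            have "y' * (x' / P * Q) = 1" if "x' * y' = P / Q" "0 < P" "0 < Q" for P Q :: real
              using that by (simp add: field_simps)
            from this[OF that(4)[unfolded r(2)] o1_pos o1_pos] show ?thesis
              unfolding t[symmetric] by (simp add: h'_def a0_def)
          qed
        qed
        moreover have "mag J V (\<lambda>x. h' x + a0 x) v - mag J V (\<lambda>x. h' x - a0 x) v \<le> 2 * mag J V a0 v"
          by (rule IH_del[OF card_less]) (use less.prems v in \<open>auto simp: a0_def\<close>)
        ultimately show ?thesis by simp
      qed
      \<comment> \<open>The case \<open>v = w\<close> of \<open>del\<close> with both odds equal to
        \<open>r\<close>: the coefficients at \<open>w\<close> are -2, 2 and 2, so comparing the
        influences compares \<open>r\<close> with \<open>z\<close>.\<close>
      have rz: "r \<le> z"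
      proof -
        have "- 2 + 4 * (r / (1 + r)) \<le> - 2 + 4 * (z / (1 + z))"
          using del[OF w(1) r(1) r(1)] zero_a0[OF w(1)]
          by (simp add: e_def AA_def BB_def G_w power2_eq_square)
        then have "(2 * r - 2) * (1 + z) \<le> (2 * z - 2) * (1 + r)" using r(1) z by (simp add: divide_simps)
        then show ?thesis by (simp add: algebra_simps)
      qed
      \<comment> \<open>Contraction leaves the fields \<open>h + (a + J w)\<close> and
        \<open>h - (a + J w)\<close> on \<open>W\<close>, to which the outer induction hypothesis
        applies.\<close>
      have con: "e h v + AA h v + BB h v \<le> e (\<lambda>_. 0) v + AA (\<lambda>_. 0) v + BB (\<lambda>_. 0) v"
      proof (cases "v = w")
        case True
        then show ?thesis by (simp add: e_def AA_def BB_def G_w)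
      next
        case False
        have vW: "v \<in> W" using False less.prems V by auto
        have "mag J W (\<lambda>x. h x + (a x + J w x)) v - mag J W (\<lambda>x. h x - (a x + J w x)) v
            \<le> 2 * mag J W (\<lambda>x. a x + J w x) v"
          by (rule IH_con) (use V less.prems J_nonneg vW in auto)
        then show ?thesis
          using mag_flip[OF vW, of J "\<lambda>x. a x + J w x"] False
          by (simp add: e_def AA_def BB_def G_v algebra_simps)
      qed
      define x where "x = exp (2 * (h w + a w)) * o1 (\<lambda>u. h u + a u)"
      define y where "y = 1 / (exp (2 * (h w - a w)) * o1 (\<lambda>u. h u - a u))"
      have xy: "0 < x" "0 < y" using o1_pos by (simp_all add: x_def y_def)
      have "exp (2 * (h w + a w)) / exp (2 * (h w - a w)) = k\<^sup>2"
        by (simp add: k_def power2_eq_square algebra_simps flip: exp_diff exp_add)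
      then have "x * y = (k * r)\<^sup>2"
        unfolding power_mult_distrib r(2) by (simp add: x_def y_def flip: times_divide_times_eq)
      moreover define X where "X = e (\<lambda>_. 0) v + AA (\<lambda>_. 0) v + BB (\<lambda>_. 0) v"
      moreover define D where "D = AA (\<lambda>_. 0) v + BB (\<lambda>_. 0) v"
      have D: "0 \<le> D" using G_le by (simp add: D_def AA_def BB_def)
      have kz: "0 < 1 + k * z" "0 < 1 + z" using k z by (auto intro: add_pos_pos)
      have "2 * mag J V a0 v = X - D * (1 - z / (1 + z))"
        unfolding zero_a0[OF less.prems(2)] X_def D_def by (simp add: algebra_simps add_divide_distrib)
      then have a0_X: "2 * mag J V a0 v = X - D / (1 + z)"
        using kz by (simp add: field_simps)
      have "2 * mag J V a v = X - D * (1 - k * z / (1 + k * z))"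
        unfolding zero_a[OF less.prems(2)] X_def D_def by (simp add: algebra_simps add_divide_distrib)
      then have a_X: "2 * mag J V a v = X - D / (1 + k * z)"
        using kz by (simp add: field_simps)
      have "mag J V (\<lambda>x. h x + a x) v - mag J V (\<lambda>x. h x - a x) v =
          e h v + AA h v * (x / (1 + x)) + BB h v * (y / (1 + y))"
        using o1_pos[of "\<lambda>u. h u - a u"] by (intro pair) (simp_all add: x_def y_def)
      ultimately have "mag J V (\<lambda>x. h x + a x) v - mag J V (\<lambda>x. h x - a x) v \<le>
          X - (1 + z) / (1 + k * z) * (X - 2 * mag J V a0 v)"
        using odds_interpolation[OF xy r(1) k _ rz, of "e h v" "AA h v" "BB h v" X "2 * mag J V a0 v"]
          con del[OF less.prems(2)] a0_X D kz by simp
      \<comment> \<open>In zero field the interpolation is exact, with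
        \<open>s = (1 + z) / (1 + k * z)\<close>.\<close>
      also have "\<dots> = 2 * mag J V a v"
        unfolding a0_X a_X using kz by simp
      finally show ?thesis .
    qed
  qed
qed

text \<open>The differential form of \<open>influence_le_zero_field\<close>: the two values of the
  spin at \<open>v\<close> act on the rest as the fields \<open>J v\<close> and
  \<open>- J v\<close>, and \<open>4 * p * (1 - p) \<le> 1\<close>.\<close>

lemma gcov_le_corr:
  assumes "finite V" "v \<in> V" "x \<in> V"
  shows "gcov J V f (\<lambda>A. spin A v) (\<lambda>A. spin A x) \<le> corr J V v x"
proof (cases "v = x")
  case True
  then show ?thesis using assms by (simp add: gcov_def gibbs_const)
next
  case False
  define W where "W = V - {v}"
  have V: "V = insert v W" "finite W" "v \<notin> W" "x \<in> W" using assms False by (auto simp: W_def)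
  define p where "p = up W f v"
  have p: "0 < p" "p < 1" using up_bounds[OF V(2)] by (auto simp: p_def)
  have "gcov J V f (\<lambda>A. spin A v) (\<lambda>A. spin A x) =
      2 * p * (1 - p) * (mag J W (\<lambda>y. f y + J v y) x - mag J W (\<lambda>y. f y - J v y) x)"
    unfolding V(1) gcov_split[OF V(2,3)] p_def using False by (simp add: spin_def)
  also have "\<dots> \<le> 2 * p * (1 - p) * (2 * mag J W (J v) x)"
    using p V J_nonneg by (intro mult_left_mono influence_le_zero_field) auto
  also have "\<dots> \<le> 1 * mag J W (J v) x"
  proof -
    have "0 \<le> (2 * p - 1)\<^sup>2" by simp
    then have "4 * p * (1 - p) \<le> 1" by (simp add: power2_eq_square algebra_simps)
    then show ?thesis
      using mult_right_mono[of "4 * p * (1 - p)" 1 "mag J W (J v) x"] mag_nonneg[of W x "J v"] V J_nonneg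
      by (simp add: algebra_simps)
  qed
  finally show ?thesis using corr_insert[OF V(2,3,4)] V(1) by simp
qed

end

section \<open>Covariances with the energy\<close>

lemma gcov_cong:
  assumes "\<And>A. A \<subseteq> V \<Longrightarrow> g A = g' A" "\<And>A. A \<subseteq> V \<Longrightarrow> k A = k' A"
    "\<And>x. x \<in> V \<Longrightarrow> f x = f' x"
  shows "gcov J V f g k = gcov J V f' g' k'"
proof -
  have "gibbs J V f (\<lambda>A. g A * k A) = gibbs J V f' (\<lambda>A. g' A * k' A)"
    "gibbs J V f g = gibbs J V f' g'" "gibbs J V f k = gibbs J V f' k'"
    by (rule gibbs_cong; simp add: assms)+
  then show ?thesis by (simp add: gcov_def)
qed

lemma gcov_commute: "gcov J V f g k = gcov J V f k g"
  by (simp add: gcov_def mult.commute)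

lemma gcov_const: "finite V \<Longrightarrow> gcov J V f (\<lambda>_. c) k = 0"
  by (simp add: gcov_def gibbs_const gibbs_cmult)

lemma gcov_shift:
  assumes "finite V"
  shows "gcov J V f g (\<lambda>A. c + k A) = gcov J V f g k"
proof -
  have "gibbs J V f (\<lambda>A. g A * (c + k A)) = gibbs J V f g * c + gibbs J V f (\<lambda>A. g A * k A)"
    by (simp add: distrib_left gibbs_add gibbs_cmult_right)
  then show ?thesis
    using assms by (simp add: gcov_def gibbs_add gibbs_const algebra_simps)
qed

text \<open>The pair part of the energy is even, so its product with a spin has mean zero and only
  the field part contributes.\<close>

lemma gcov_energy_zero_field:
  assumes "w \<in> V"
  shows "gcov J V (\<lambda>_. 0) (\<lambda>A. spin A w) (energy K V c) = (\<Sum>x\<in>V. c x * corr J V x w)"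
proof -
  have "gibbs J V (\<lambda>_. 0) (\<lambda>A. spin A w) = 0"
    using assms by (intro gibbs_odd) (simp add: spin_compl)
  moreover have "gibbs J V (\<lambda>_. 0) (\<lambda>A. spin A w * (\<Sum>x\<in>V. \<Sum>y\<in>V. K x y * (spin A x * spin A y)) / 2) = 0"
    using assms by (intro gibbs_odd) (simp add: spin_compl cong: sum.cong)
  moreover have "gibbs J V (\<lambda>_. 0) (\<lambda>A. spin A w * (\<Sum>x\<in>V. c x * spin A x)) = (\<Sum>x\<in>V. c x * corr J V x w)"
    unfolding sum_distrib_left gibbs_sum gibbs_cmult[symmetric]
    by (simp add: mult_ac)
  ultimately show ?thesis
    by (simp add: gcov_def energy_def distrib_left gibbs_add)
qed

context ferromagnet
begin

text \<open>The same \<open>s\<close> serves every \<open>g\<close>, so the mixture also applies to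
  products and hence to covariances. Through the second identity, a covariance with the spin at
  \<open>x\<close> in the deleted measure controls the change from deletion to contraction.\<close>

lemma field_mixture:
  assumes "finite W" "x \<notin> W" "0 \<le> b x"
  defines "D \<equiv> gibbs J (insert x W) (b(x := 0))"
    and "C \<equiv> \<lambda>g. gibbs J W (\<lambda>u. b u + J x u) (\<lambda>A. g (insert x A))"
  obtains s p where "0 \<le> s" "s \<le> 1" "0 < p"
    "\<And>g. gibbs J (insert x W) b g = (1 - s) * D g + s * C g"
    "\<And>g. gcov J (insert x W) (b(x := 0)) (\<lambda>A. spin A x) g = p * (C g - D g)"
proof -
  define p0 where "p0 = up W (b(x := 0)) x"
  define p where "p = up W b x"
  have p0: "0 < p0" "p0 < 1" and p: "p < 1" using up_bounds[OF assms(1)] by (simp_all add: p0_def p_def)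
  have odds: "odds W (b(x := 0)) x = odds W b x"
    using assms(2) by (intro odds_cong) auto
  have "p0 \<le> p"
  proof -
    have o: "0 < odds W b x" by (rule odds_pos) fact
    have "1 * odds W b x \<le> exp (2 * b x) * odds W b x"
      using assms(3) o by (intro mult_right_mono) auto
    moreover have "a / (1 + a) \<le> b / (1 + b)" if "0 \<le> a" "a \<le> b" for a b :: real
      using that by (simp add: divide_simps) (simp add: algebra_simps)
    ultimately show ?thesis using o by (simp add: p0_def p_def up_def odds)
  qed
  \<comment> \<open>Solves \<open>p = (1 - s) * p0 + s\<close>, which matches the probabilities of a
    plus spin at \<open>x\<close>.\<close>
  define s where "s = (p - p0) / (1 - p0)"
  have s: "0 \<le> s" "s \<le> 1" "p = (1 - s) * p0 + s"
  proof -
    show "0 \<le> s" "s \<le> 1" using p0 p \<open>p0 \<le> p\<close> by (simp_all add: s_def)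
    have "s * (1 - p0) = p - p0" using p0 by (simp add: s_def)
    then show "p = (1 - s) * p0 + s" by (simp add: algebra_simps)
  qed
  define M where "M g = gibbs J W (\<lambda>u. b u - J x u) g" for g
  have "gibbs J W (\<lambda>u. (b(x := 0)) u - J x u) g = M g"
    "gibbs J W (\<lambda>u. (b(x := 0)) u + J x u) (\<lambda>A. g (insert x A)) = C g" for g
    unfolding M_def C_def using assms(2) by (auto intro!: gibbs_cong_field)
  then have D: "D g = p0 * C g + (1 - p0) * M g"
    and cov: "gcov J (insert x W) (b(x := 0)) (\<lambda>A. spin A x) g = 2 * p0 * (1 - p0) * (C g - M g)" for g
    unfolding D_def gibbs_split[OF assms(1,2)] gcov_split[OF assms(1,2)] p0_def[symmetric] by simp_all
  show ?thesis
  proof (rule that[OF s(1,2), of "2 * p0"])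
    show "0 < 2 * p0" using p0 by simp
    show "gibbs J (insert x W) b g = (1 - s) * D g + s * C g" for g
    proof -
      have "gibbs J (insert x W) b g = p * C g + (1 - p) * M g"
        unfolding gibbs_split[OF assms(1,2)] p_def M_def C_def ..
      then show ?thesis unfolding s(3) D by (simp add: algebra_simps)
    qed
    show "gcov J (insert x W) (b(x := 0)) (\<lambda>A. spin A x) g = 2 * p0 * (C g - D g)" for g
      unfolding cov D by (simp add: algebra_simps)
  qed
qed

text \<open>
  For \<open>\<phi> = 0\<close> this is the second Griffiths inequality, and for \<open>w = v\<close> the inequality of
  Duminil-Copin and Tassion. The induction needs all \<open>w\<close>: the change of the mean energy between the
  deleted and the contracted measure at \<open>x\<close> is controlled by the deleted measure with \<open>w = x\<close>.
\<close>

lemma gcov_energy_ge: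
  assumes K: "ferromagnet K"
    and "finite V" "\<And>x. x \<in> V \<Longrightarrow> 0 \<le> b x" "\<And>x. x \<in> V \<Longrightarrow> 0 \<le> c x" "0 \<le> \<phi>" "w \<in> V"
    and "\<And>S. S \<subseteq> V \<Longrightarrow> v \<in> S \<Longrightarrow> \<phi> \<le> (\<Sum>x\<in>S. corr J S v x * ((\<Sum>y\<in>V - S. K x y) + c x))"
  shows "\<phi> * gcov J V b (\<lambda>A. spin A v) (\<lambda>A. spin A w) \<le> gcov J V b (\<lambda>A. spin A w) (energy K V c)"
  using assms(2-)
proof (induction V arbitrary: b c \<phi> w rule: finite_psubset_induct)
  case (psubset V)
  note IH_con = psubset.IH
  interpret K: ferromagnet K by (rule K)
  from psubset.prems show ?case
  proof (induction "card {x \<in> V. b x \<noteq> 0}" arbitrary: b w rule: less_induct)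
    case less
    note IH_del = less.hyps
    show ?case
    proof (cases "\<forall>x\<in>V. b x = 0")
      case True
      have "gcov J V b (\<lambda>A. spin A w) (energy K V c) = (\<Sum>x\<in>V. c x * corr J V x w)"
      proof -
        have "gcov J V b (\<lambda>A. spin A w) (energy K V c) =
            gcov J V (\<lambda>_. 0) (\<lambda>A. spin A w) (energy K V c)"
          by (rule gcov_cong) (simp_all add: True)
        then show ?thesis by (simp only: gcov_energy_zero_field[OF less.prems(4)])
      qed
      moreover have "\<phi> * gcov J V b (\<lambda>A. spin A v) (\<lambda>A. spin A w) \<le> (\<Sum>x\<in>V. c x * corr J V x w)"
      proof (cases "v \<in> V")
        case v: True
        have "gcov J V b (\<lambda>A. spin A v) (\<lambda>A. spin A w) = corr J V v w"
        proof -
          have "gcov J V b (\<lambda>A. spin A v) (\<lambda>A. spin A w) =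
              gcov J V (\<lambda>_. 0) (\<lambda>A. spin A v) (\<lambda>A. spin A w)"
            by (rule gcov_cong) (simp_all add: True)
          then show ?thesis by (simp add: gcov_def mag_zero_field v)
        qed
        then have "\<phi> * gcov J V b (\<lambda>A. spin A v) (\<lambda>A. spin A w) = \<phi> * corr J V v w"
          by (simp only:)
        \<comment> \<open>The hypothesis is used for \<open>S = V\<close>, where only the fields
          \<open>c\<close> remain; afterwards \<open>corr_mult_le\<close> eliminates
          \<open>v\<close>.\<close>
        also have "\<phi> * corr J V v w \<le> (\<Sum>x\<in>V. corr J V v x * c x) * corr J V v w"
          using less.prems(5)[of V] v less.prems(4) psubset.hyps
          by (intro mult_right_mono corr_nonneg) auto
        also have "\<dots> = (\<Sum>x\<in>V. c x * (corr J V v x * corr J V v w))"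
          unfolding sum_distrib_right by (intro sum.cong refl) (simp only: mult_ac)
        also have "\<dots> \<le> (\<Sum>x\<in>V. c x * corr J V x w)"
          using v less.prems psubset.hyps by (intro sum_mono mult_left_mono corr_mult_le) auto
        finally show ?thesis .
      next
        case v: False
        have "gcov J V b (\<lambda>A. spin A v) (\<lambda>A. spin A w) = gcov J V b (\<lambda>A. -1) (\<lambda>A. spin A w)"
          using v by (intro gcov_cong) (auto simp: spin_def)
        moreover have "0 \<le> (\<Sum>x\<in>V. c x * corr J V x w)"
          using less.prems psubset.hyps by (intro sum_nonneg mult_nonneg_nonneg corr_nonneg) auto
        ultimately show ?thesis using psubset.hyps by (simp add: gcov_const)
      qed
      ultimately show ?thesis by simp
    next
      case False
      then obtain x where x: "x \<in> V" "b x \<noteq> 0" by blast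
      define W where "W = V - {x}"
      have V: "V = insert x W" "finite W" "x \<notin> W" "W \<subset> V"
        using x psubset.hyps by (auto simp: W_def)
      define D where "D = gibbs J V (b(x := 0))"
      define C where "C = (\<lambda>g. gibbs J W (\<lambda>u. b u + J x u) (\<lambda>A. g (insert x A)))"
      define H where "H = energy K V c"
      define sp where "sp u = (\<lambda>A. spin A u)" for u :: 'a
      obtain s p where s: "0 \<le> s" "s \<le> 1" and p: "0 < p"
        and mix: "\<And>g. gibbs J V b g = (1 - s) * D g + s * C g"
        and cov: "\<And>g. gcov J V (b(x := 0)) (sp x) g = p * (C g - D g)"
        by (rule field_mixture[of W x b, folded V(1), OF V(2,3) less.prems(1)[OF x(1)]])
          (rule that, unfold D_def C_def sp_def)
      define \<gamma>D where "\<gamma>D = gcov J V (b(x := 0))"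
      define \<gamma>C where "\<gamma>C = (\<lambda>g k. gcov J W (\<lambda>u. b u + J x u) (\<lambda>A. g (insert x A)) (\<lambda>A. k (insert x A)))"
      \<comment> \<open>The law of total covariance for a mixture of two measures.\<close>
      have mix_cov: "gcov J V b g k =
          (1 - s) * \<gamma>D g k + s * \<gamma>C g k + s * (1 - s) * ((C g - D g) * (C k - D k))" for g k
        unfolding gcov_def mix \<gamma>D_def \<gamma>C_def D_def[symmetric] C_def[symmetric]
        by (simp add: C_def) (simp add: algebra_simps)
      have "card {u \<in> V. (b(x := 0)) u \<noteq> 0} < card {u \<in> V. b u \<noteq> 0}"
        using x psubset.hyps by (intro psubset_card_mono) auto
      then have del: "\<phi> * \<gamma>D (sp v) (sp u) \<le> \<gamma>D (sp u) H" if "u \<in> V" for u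
        unfolding \<gamma>D_def H_def sp_def
        by (rule IH_del) (use less.prems that in auto)
      \<comment> \<open>The inner induction hypothesis with \<open>x\<close> in place of
        \<open>w\<close>; the common factor \<open>p\<close> cancels.\<close>
      have incr: "\<phi> * (C (sp v) - D (sp v)) \<le> C H - D H"
      proof -
        have "\<phi> * (p * (C (sp v) - D (sp v))) \<le> p * (C H - D H)"
          using del[OF x(1)] by (simp add: \<gamma>D_def gcov_commute[of _ _ _ "sp v"] cov)
        then have "p * (\<phi> * (C (sp v) - D (sp v))) \<le> p * (C H - D H)" by (simp add: mult_ac)
        then show ?thesis using p by simp
      qed
      have "0 \<le> p * (C (sp w) - D (sp w))"
        unfolding cov[symmetric] using x psubset.hyps unfolding sp_def
        by (intro gcov_nonneg) (auto simp: spin_mono)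
      then have w_nonneg: "0 \<le> C (sp w) - D (sp w)" using p by (simp add: zero_le_mult_iff)
      have con: "\<phi> * \<gamma>C (sp v) (sp w) \<le> \<gamma>C (sp w) H"
      proof (cases "w = x")
        case True
        then have "\<gamma>C (sp w) g = 0" "\<gamma>C g (sp w) = 0" for g
          using V(2) by (simp_all add: \<gamma>C_def sp_def spin_def gcov_const gcov_commute[of _ _ _ _ "\<lambda>_. 1"])
        then show ?thesis by simp
      next
        case False
        then have wW: "w \<in> W" using less.prems V by auto
        have sp_ins: "(\<lambda>A. sp u (insert x A)) = (\<lambda>A. spin A u)" if "u \<noteq> x" for u
          using that by (simp add: sp_def spin_def fun_eq_iff)
        have "H (insert x A) = c x + energy K W (\<lambda>u. c u + K x u) A" if "A \<subseteq> W" for A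
        proof -
          have "energy K W (\<lambda>u. c u + K x u) (insert x A) = energy K W (\<lambda>u. c u + K x u) A"
            using V(3) by (intro K.energy_cong) (auto simp: spin_def)
          then show ?thesis
            unfolding H_def V(1) using K.energy_insert[OF V(2,3), of c "insert x A"]
            by (simp add: spin_def[of _ x])
        qed
        then have "\<gamma>C (sp w) H = gcov J W (\<lambda>u. b u + J x u) (\<lambda>A. spin A w)
            (\<lambda>A. c x + energy K W (\<lambda>u. c u + K x u) A)"
          unfolding \<gamma>C_def sp_ins[OF False] by (intro gcov_cong) auto
        also have "\<dots> = gcov J W (\<lambda>u. b u + J x u) (\<lambda>A. spin A w) (energy K W (\<lambda>u. c u + K x u))"
          by (rule gcov_shift[OF V(2)])
        finally have H: "\<gamma>C (sp w) H = \<dots>" .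
        \<comment> \<open>If \<open>v\<close> is the contracted vertex, its spin is constant and the
          constant 0 suffices. Otherwise \<open>x\<close> leaves \<open>V - S\<close> and its
          coupling reappears in the field \<open>c u + K x u\<close>, so the hypothesis on the sets
          \<open>S\<close> carries over to \<open>W\<close>.\<close>
        define \<psi> where "\<psi> = (if v = x then 0 else \<phi>)"
        have "\<psi> * gcov J W (\<lambda>u. b u + J x u) (\<lambda>A. spin A v) (\<lambda>A. spin A w) \<le> \<gamma>C (sp w) H"
          unfolding H
        proof (rule IH_con[OF V(4) _ _ _ wW])
          show "0 \<le> b u + J x u" "0 \<le> c u + K x u" if "u \<in> W" for u
            using that V less.prems J_nonneg K.J_nonneg by auto
          show "0 \<le> \<psi>" using less.prems by (simp add: \<psi>_def)
          show "\<psi> \<le> (\<Sum>u\<in>S. corr J S v u * ((\<Sum>y\<in>W - S. K u y) + (c u + K x u)))"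
            if S: "S \<subseteq> W" "v \<in> S" for S
          proof -
            have "v \<noteq> x" "x \<notin> S" "V - S = insert x (W - S)" using S V(1,3) by auto
            then have "(\<Sum>y\<in>V - S. K u y) = K x u + (\<Sum>y\<in>W - S. K u y)" for u
              using V(2,3) by (simp add: K.J_sym[of u x])
            then show ?thesis
              using less.prems(5)[of S] S V(4) \<open>v \<noteq> x\<close> by (auto simp: \<psi>_def add_ac)
          qed
        qed
        moreover have "\<phi> * \<gamma>C (sp v) (sp w) =
            \<psi> * gcov J W (\<lambda>u. b u + J x u) (\<lambda>A. spin A v) (\<lambda>A. spin A w)"
        proof (cases "v = x")
          case True
          then show ?thesis using V(2) by (simp add: \<psi>_def \<gamma>C_def sp_def spin_def[of _ x] gcov_const)
        next
          case False
          then show ?thesis using \<open>w \<noteq> x\<close> by (simp add: \<psi>_def \<gamma>C_def sp_ins)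
        qed
        ultimately show ?thesis by simp
      qed
      have "\<phi> * gcov J V b (sp v) (sp w) =
          (1 - s) * (\<phi> * \<gamma>D (sp v) (sp w)) + s * (\<phi> * \<gamma>C (sp v) (sp w)) +
          s * (1 - s) * ((C (sp w) - D (sp w)) * (\<phi> * (C (sp v) - D (sp v))))"
        unfolding mix_cov by (simp add: algebra_simps)
      also have "\<dots> \<le> (1 - s) * \<gamma>D (sp w) H + s * \<gamma>C (sp w) H +
          s * (1 - s) * ((C (sp w) - D (sp w)) * (C H - D H))"
        using s del[OF less.prems(4)] con incr w_nonneg
        by (intro add_mono mult_left_mono) auto
      also have "\<dots> = gcov J V b (sp w) H" unfolding mix_cov ..
      finally show ?thesis by (simp add: sp_def H_def)
    qed
  qed
qed

end

section \<open>Derivatives and monotonicity in the couplings\<close>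

lemma energy_line:
  "energy (\<lambda>x y. J x y + t * K x y) V (\<lambda>x. f x + t * c x) A = energy J V f A + t * energy K V c A"
  by (simp add: energy_def algebra_simps sum.distrib sum_distrib_left add_divide_distrib)

text \<open>The energy is affine in \<open>t\<close> with slope \<open>energy K V c\<close>.
  Differentiating the weights brings down this factor, and the quotient rule produces a
  covariance.\<close>

lemma gibbs_has_derivative:
  assumes "finite V"
  shows "((\<lambda>t. gibbs (\<lambda>x y. J x y + t * K x y) V (\<lambda>x. f x + t * c x) g) has_real_derivative
    gcov (\<lambda>x y. J x y + t * K x y) V (\<lambda>x. f x + t * c x) g (energy K V c)) (at t)"
proof -
  define Jt where "Jt t = (\<lambda>x y. J x y + t * K x y)" for t
  define ft where "ft t = (\<lambda>x. f x + t * c x)" for t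
  have D: "((\<lambda>t. wsum (Jt t) V (ft t) g) has_real_derivative
      wsum (Jt t) V (ft t) (\<lambda>A. g A * energy K V c A)) (at t)" for g
    unfolding wsum_def Jt_def ft_def energy_line
    by (rule derivative_eq_intros refl | simp add: mult_ac)+
  have "((\<lambda>t. wsum (Jt t) V (ft t) g / pfun (Jt t) V (ft t)) has_real_derivative
      (wsum (Jt t) V (ft t) (\<lambda>A. g A * energy K V c A) * pfun (Jt t) V (ft t) -
       wsum (Jt t) V (ft t) g * wsum (Jt t) V (ft t) (\<lambda>A. 1 * energy K V c A)) /
       (pfun (Jt t) V (ft t) * pfun (Jt t) V (ft t))) (at t)"
    using pfun_pos[OF assms, of "Jt t" "ft t"] by (intro DERIV_divide D) auto
  moreover have "(N * Z - M * L) / (Z * Z) = N / Z - M / Z * (L / Z)" if "Z > 0" for N M L Z :: real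
    using that by (simp add: field_simps)
  ultimately show ?thesis
    using pfun_pos[OF assms, of "Jt t" "ft t"]
    by (simp add: gibbs_def gcov_def flip: Jt_def ft_def)
qed

lemma ferromagnet_line:
  assumes "ferromagnet J" "ferromagnet K" "0 \<le> t"
  shows "ferromagnet (\<lambda>x y. J x y + t * K x y)"
  using assms by (simp add: ferromagnet_def)

text \<open>Along the segment between the two couplings and fields the derivative is a covariance
  with an energy, nonnegative by \<open>gcov_energy_ge\<close> with constant 0.\<close>

lemma mag_mono_coupling:
  assumes "ferromagnet J" "ferromagnet J'" "finite V" "w \<in> V"
    and "\<And>x y. J x y \<le> J' x y" "\<And>x. x \<in> V \<Longrightarrow> 0 \<le> f x" "\<And>x. x \<in> V \<Longrightarrow> f x \<le> f' x"
  shows "mag J V f w \<le> mag J' V f' w"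
proof -
  define K where "K x y = J' x y - J x y" for x y
  define c where "c x = f' x - f x" for x
  have K: "ferromagnet K"
    using assms(1,2,5) by (auto simp: ferromagnet_def K_def)
  define F where "F t = mag (\<lambda>x y. J x y + t * K x y) V (\<lambda>x. f x + t * c x) w" for t
  have "F 0 \<le> F 1"
  proof (rule DERIV_nonneg_imp_nondecreasing[of 0 1 F])
    fix t :: real assume t: "0 \<le> t" "t \<le> 1"
    interpret ferromagnet "\<lambda>x y. J x y + t * K x y"
      by (rule ferromagnet_line) (use assms K t in auto)
    have "(F has_real_derivative gcov (\<lambda>x y. J x y + t * K x y) V (\<lambda>x. f x + t * c x)
        (\<lambda>A. spin A w) (energy K V c)) (at t)"
      unfolding F_def by (rule gibbs_has_derivative) fact
    moreover have "0 \<le> gcov (\<lambda>x y. J x y + t * K x y) V (\<lambda>x. f x + t * c x)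
        (\<lambda>A. spin A w) (energy K V c)"
    proof -
      have nonneg: "0 \<le> f x + t * c x" "0 \<le> c x" if "x \<in> V" for x
        using that assms t by (simp_all add: c_def)
      have "0 \<le> (\<Sum>x\<in>S. corr (\<lambda>x y. J x y + t * K x y) S w x * ((\<Sum>y\<in>V - S. K x y) + c x))"
        if "S \<subseteq> V" "w \<in> S" for S
        using that K nonneg(2) assms(3) finite_subset[OF that(1) assms(3)]
        by (intro sum_nonneg mult_nonneg_nonneg corr_nonneg add_nonneg_nonneg)
           (auto simp: ferromagnet_def)
      then show ?thesis
        using gcov_energy_ge[OF K assms(3) nonneg order_refl assms(4), where v = w] by simp
    qed
    ultimately show "\<exists>y. (F has_real_derivative y) (at t) \<and> 0 \<le> y" by blast
  qed simp
  then show ?thesis by (simp add: F_def K_def c_def)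
qed

lemma corr_mono_coupling:
  assumes "ferromagnet J" "ferromagnet J'" "finite V" "v \<in> V" "w \<in> V"
    and "\<And>x y. J x y \<le> J' x y"
  shows "corr J V v w \<le> corr J' V v w"
proof (cases "v = w")
  case True
  then show ?thesis using assms by (simp add: gibbs_const)
next
  case False
  have V: "V = insert v (V - {v})" using assms by auto
  have "corr I V v w = mag I (V - {v}) (I v) w" if "ferromagnet I" for I
    using ferromagnet.corr_insert[OF that, of "V - {v}" v w] assms False V by auto
  then show ?thesis
    using mag_mono_coupling[OF assms(1,2), of "V - {v}" w "J v" "J' v"] assms False
    by (auto simp: ferromagnet_def)
qed

section \<open>Monotonicity in the domain\<close>

context ferromagnet
begin

text \<open>For spins in \<open>W\<close>, the measure on \<open>W\<close> is the one on
  \<open>insert w W\<close> with the couplings at \<open>w\<close> cut; restoring them raises the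
  magnetization.\<close>

lemma mag_insert_vertex:
  assumes "finite W" "w \<notin> W" "x \<in> W" "\<And>y. y \<in> insert w W \<Longrightarrow> 0 \<le> f y"
  shows "mag J W f x \<le> mag J (insert w W) f x"
proof -
  define J0 where "J0 y z = (if y = w \<or> z = w then 0 else J y z)" for y z
  have J0: "ferromagnet J0"
    using J_sym J_nonneg by (simp add: ferromagnet_def J0_def)
  have "mag J W f x = mag J0 W f x"
    using assms(2) by (intro gibbs_cong) (auto simp: J0_def)
  also have "\<dots> = mag J0 (insert w W) f x"
  proof -
    have "spin (insert w A) x = spin A x" for A using assms by (auto simp: spin_def)
    then show ?thesis
      by (simp add: ferromagnet.gibbs_split[OF J0 assms(1,2)] J0_def algebra_simps)
  qed
  also have "\<dots> \<le> mag J (insert w W) f x"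
    using assms J_nonneg by (intro mag_mono_coupling J0 ferromagnet_axioms) (auto simp: J0_def)
  finally show ?thesis .
qed

lemma mag_domain_mono:
  assumes "finite V" "W \<subseteq> V" "x \<in> W" "\<And>y. y \<in> V \<Longrightarrow> 0 \<le> f y"
  shows "mag J W f x \<le> mag J V f x"
proof -
  have "finite R \<Longrightarrow> R \<inter> W = {} \<Longrightarrow> (\<And>y. y \<in> R \<union> W \<Longrightarrow> 0 \<le> f y) \<Longrightarrow>
    mag J W f x \<le> mag J (R \<union> W) f x" for R
  proof (induction R rule: finite_induct)
    case (insert w R)
    have "mag J W f x \<le> mag J (R \<union> W) f x" using insert by auto
    also have "\<dots> \<le> mag J (insert w (R \<union> W)) f x"
      using insert assms finite_subset[OF assms(2,1)] by (intro mag_insert_vertex) auto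
    finally show ?case by simp
  qed simp
  moreover have "(V - W) \<inter> W = {}" "V - W \<union> W = V" using assms(2) by auto
  ultimately show ?thesis using assms by (metis finite_Diff)
qed

lemma corr_domain_mono:
  assumes "finite V" "W \<subseteq> V" "v \<in> W" "x \<in> W"
  shows "corr J W v x \<le> corr J V v x"
proof (cases "v = x")
  case True
  then show ?thesis using assms finite_subset[OF assms(2,1)] by (simp add: gibbs_const)
next
  case False
  have eq: "corr J U v x = mag J (U - {v}) (J v) x" if "finite U" "v \<in> U" "x \<in> U" for U
    using corr_insert[of "U - {v}" v x] that False by (simp add: insert_absorb)
  have "finite W" "v \<in> V" "x \<in> V" using assms finite_subset[OF assms(2,1)] by auto
  moreover have "mag J (W - {v}) (J v) x \<le> mag J (V - {v}) (J v) x"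
    using assms False J_nonneg by (intro mag_domain_mono) auto
  ultimately show ?thesis using eq[of W] eq[of V] assms by (simp only:)
qed

end

section \<open>The Simon-Lieb inequality and the total influence\<close>

context ferromagnet
begin

lemma energy_Un:
  assumes "finite S" "finite R" "S \<inter> R = {}" "A \<subseteq> S" "B \<subseteq> R"
  shows "energy J (S \<union> R) f (A \<union> B) =
    energy J R f B + energy J S (\<lambda>x. f x + (\<Sum>y\<in>R. J x y * spin B y)) A"
proof -
  have sp: "spin (A \<union> B) x = spin A x" if "x \<in> S" for x
    using that assms by (auto simp: spin_def)
  have sp': "spin (A \<union> B) x = spin B x" if "x \<in> R" for x
    using that assms by (auto simp: spin_def)
  have "(\<Sum>x\<in>R. \<Sum>y\<in>S. J x y * (spin B x * spin A y)) =
      (\<Sum>x\<in>S. \<Sum>y\<in>R. J x y * (spin A x * spin B y))"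
    by (subst sum.swap) (simp add: J_sym mult.commute)
  moreover have "(\<Sum>x\<in>S. (\<Sum>y\<in>R. J x y * spin B y) * spin A x) =
      (\<Sum>x\<in>S. \<Sum>y\<in>R. J x y * (spin A x * spin B y))"
    by (simp add: sum_distrib_left sum_distrib_right mult_ac)
  ultimately show ?thesis
    using assms(1-3) unfolding energy_def
    by (simp add: sum.union_disjoint sp sp' sum.distrib distrib_right add_divide_distrib)
qed

lemma sum_Pow_Un:
  assumes "S \<inter> R = {}"
  shows "(\<Sum>C\<in>Pow (S \<union> R). F C) = (\<Sum>B\<in>Pow R. \<Sum>A\<in>Pow S. F (A \<union> B) :: real)"
proof -
  have "bij_betw (\<lambda>(B, A). A \<union> B) (Pow R \<times> Pow S) (Pow (S \<union> R))"
    by (rule bij_betw_byWitness[where f' = "\<lambda>C. (C \<inter> R, C \<inter> S)"]) (use assms in auto)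
  from sum.reindex_bij_betw[OF this, of F] show ?thesis
    by (simp add: sum.cartesian_product case_prod_unfold)
qed

lemma wsum_Un:
  assumes "finite S" "finite R" "S \<inter> R = {}"
  shows "wsum J (S \<union> R) f g = (\<Sum>B\<in>Pow R. exp (energy J R f B) *
    wsum J S (\<lambda>x. f x + (\<Sum>y\<in>R. J x y * spin B y)) (\<lambda>A. g (A \<union> B)))"
  unfolding wsum_def sum_Pow_Un[OF assms(3)] sum_distrib_left
  by (intro sum.cong refl) (simp add: energy_Un[OF assms] exp_add)

text \<open>The spatial Markov property: the spins in \<open>R\<close> enter the conditional measure
  on \<open>S\<close> as an additional field.\<close>

lemma gibbs_tower:
  assumes "finite S" "finite R" "S \<inter> R = {}"
  shows "gibbs J (S \<union> R) f g = gibbs J (S \<union> R) f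
    (\<lambda>C. gibbs J S (\<lambda>x. f x + (\<Sum>y\<in>R. J x y * spin C y)) (\<lambda>A. g (A \<union> C \<inter> R)))"
proof -
  have "wsum J (S \<union> R) f (\<lambda>C. gibbs J S (\<lambda>x. f x + (\<Sum>y\<in>R. J x y * spin C y)) (\<lambda>A. g (A \<union> C \<inter> R)))
      = wsum J (S \<union> R) f g"
    unfolding wsum_Un[OF assms]
  proof (intro sum.cong refl arg_cong2[of _ _ _ _ "(*)"])
    fix B assume B: "B \<in> Pow R"
    define \<kappa> where "\<kappa> x = f x + (\<Sum>y\<in>R. J x y * spin B y)" for x
    have "wsum J S \<kappa> (\<lambda>A. gibbs J S (\<lambda>x. f x + (\<Sum>y\<in>R. J x y * spin (A \<union> B) y))
        (\<lambda>A'. g (A' \<union> (A \<union> B) \<inter> R))) = wsum J S \<kappa> (\<lambda>A. gibbs J S \<kappa> (\<lambda>A'. g (A' \<union> B)))"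
    proof (rule wsum_cong)
      fix A assume "A \<subseteq> S"
      then have "(A \<union> B) \<inter> R = B" "\<And>y. y \<in> R \<Longrightarrow> spin (A \<union> B) y = spin B y"
        using B assms(3) by (auto simp: spin_def)
      then show "gibbs J S (\<lambda>x. f x + (\<Sum>y\<in>R. J x y * spin (A \<union> B) y))
        (\<lambda>A'. g (A' \<union> (A \<union> B) \<inter> R)) = gibbs J S \<kappa> (\<lambda>A'. g (A' \<union> B))"
        by (simp add: \<kappa>_def[abs_def])
    qed auto
    also have "\<dots> = wsum J S \<kappa> (\<lambda>A. g (A \<union> B))"
      using wsum_cmult[of J S \<kappa> "gibbs J S \<kappa> (\<lambda>A'. g (A' \<union> B))" "\<lambda>_. 1"] pfun_pos[OF assms(1), of J \<kappa>]
      by (simp add: gibbs_def)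
    finally show "wsum J S (\<lambda>x. f x + (\<Sum>y\<in>R. J x y * spin B y))
        (\<lambda>A. gibbs J S (\<lambda>x. f x + (\<Sum>y\<in>R. J x y * spin (A \<union> B) y)) (\<lambda>A'. g (A' \<union> (A \<union> B) \<inter> R))) =
        wsum J S (\<lambda>x. f x + (\<Sum>y\<in>R. J x y * spin B y)) (\<lambda>A. g (A \<union> B))"
      by (simp only: \<kappa>_def[abs_def])
  qed
  then show ?thesis by (simp add: gibbs_def[of J "S \<union> R"])
qed

text \<open>Along the segment from \<open>f\<close> to \<open>f'\<close> the derivative of the
  magnetization is a sum of covariances weighted by \<open>f' - f\<close>, and
  \<open>gcov_le_corr\<close> bounds each by its zero-field value.\<close>

lemma mag_diff_le_corr:
  assumes "finite S" "v \<in> S" "\<And>x. x \<in> S \<Longrightarrow> f x \<le> f' x"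
  shows "mag J S f' v - mag J S f v \<le> (\<Sum>x\<in>S. corr J S v x * (f' x - f x))"
proof -
  define c where "c x = f' x - f x" for x
  define F where "F t = t * (\<Sum>x\<in>S. corr J S v x * c x) - mag J S (\<lambda>x. f x + t * c x) v" for t
  have "F 0 \<le> F 1"
  proof (rule DERIV_nonneg_imp_nondecreasing[of 0 1 F])
    fix t :: real
    have "((\<lambda>t. mag J S (\<lambda>x. f x + t * c x) v) has_real_derivative
       gcov J S (\<lambda>x. f x + t * c x) (\<lambda>A. spin A v) (energy (\<lambda>_ _. 0) S c)) (at t)"
      using gibbs_has_derivative[OF assms(1), of J "\<lambda>_ _. 0" f c "\<lambda>A. spin A v" t] by simp
    then have "(F has_real_derivative (\<Sum>x\<in>S. corr J S v x * c x) -
        gcov J S (\<lambda>x. f x + t * c x) (\<lambda>A. spin A v) (energy (\<lambda>_ _. 0) S c)) (at t)"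
      unfolding F_def by (auto intro!: derivative_eq_intros)
    moreover have "gcov J S (\<lambda>x. f x + t * c x) (\<lambda>A. spin A v) (energy (\<lambda>_ _. 0) S c) =
        (\<Sum>x\<in>S. gcov J S (\<lambda>x. f x + t * c x) (\<lambda>A. spin A v) (\<lambda>A. spin A x) * c x)"
    proof -
      have "energy (\<lambda>_ _. 0) S c = (\<lambda>A. \<Sum>x\<in>S. spin A x * c x)"
        by (simp add: energy_def mult.commute fun_eq_iff)
      then show ?thesis
        by (simp add: gcov_def sum_distrib_left gibbs_sum mult.assoc[symmetric] gibbs_cmult_right
            left_diff_distrib sum_subtractf)
    qed
    moreover have "\<dots> \<le> (\<Sum>x\<in>S. corr J S v x * c x)"
      using assms by (intro sum_mono mult_right_mono gcov_le_corr) (auto simp: c_def)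
    ultimately show "\<exists>y. (F has_real_derivative y) (at t) \<and> 0 \<le> y" by fastforce
  qed simp
  then show ?thesis by (simp add: F_def c_def)
qed

text \<open>
  Given the spins outside \<open>S\<close>, which act on \<open>S\<close> as a field \<open>\<kappa>\<close>, the difference \<open>\<Phi>\<close> of the two sides is an
  odd increasing function of them, so its mean in a nonnegative field \<open>b\<close> is nonnegative by FKG.
\<close>

lemma simon_lieb:
  assumes "finite S" "finite R" "S \<inter> R = {}" "v \<in> S"
    and b: "\<And>x. x \<in> R \<Longrightarrow> 0 \<le> b x" "\<And>x. x \<in> S \<Longrightarrow> b x = 0"
  shows "mag J (S \<union> R) b v \<le> (\<Sum>x\<in>S. corr J S v x * (\<Sum>y\<in>R. J x y * mag J (S \<union> R) b y))"
proof -
  let ?V = "S \<union> R"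
  define \<kappa> where "\<kappa> C x = (\<Sum>y\<in>R. J x y * spin C y)" for C x
  define \<Phi> where "\<Phi> C = (\<Sum>x\<in>S. corr J S v x * \<kappa> C x) - mag J S (\<kappa> C) v" for C
  have finV: "finite ?V" using assms by simp
  \<comment> \<open>By \<open>mag_diff_le_corr\<close> the magnetization grows no faster than the
    linear term.\<close>
  have "\<Phi> A \<le> \<Phi> B" if "A \<subseteq> B" for A B
  proof -
    have "mag J S (\<kappa> B) v - mag J S (\<kappa> A) v \<le> (\<Sum>x\<in>S. corr J S v x * (\<kappa> B x - \<kappa> A x))"
      using assms that unfolding \<kappa>_def
      by (intro mag_diff_le_corr sum_mono mult_left_mono spin_mono J_nonneg) auto
    then show ?thesis by (simp add: \<Phi>_def right_diff_distrib sum_subtractf)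
  qed
  then have "gibbs J ?V (\<lambda>x. - b x) \<Phi> \<le> gibbs J ?V b \<Phi>"
    using b by (intro fkg finV) force+
  moreover have "gibbs J ?V (\<lambda>x. - b x) \<Phi> = - gibbs J ?V b \<Phi>"
    unfolding gibbs_flip gibbs_minus[symmetric]
  proof (rule gibbs_cong_fun)
    fix C
    have "\<kappa> (?V - C) = (\<lambda>x. - \<kappa> C x)"
      by (rule ext) (simp add: \<kappa>_def spin_compl flip: sum_negf)
    then show "\<Phi> (?V - C) = - \<Phi> C"
      using assms(4) by (simp add: \<Phi>_def mag_flip sum_negf)
  qed
  ultimately have "0 \<le> gibbs J ?V b \<Phi>" by simp
  moreover have "gibbs J ?V b \<Phi> =
      (\<Sum>x\<in>S. corr J S v x * (\<Sum>y\<in>R. J x y * mag J ?V b y)) - gibbs J ?V b (\<lambda>C. mag J S (\<kappa> C) v)"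
    unfolding \<Phi>_def \<kappa>_def by (simp add: gibbs_diff gibbs_sum gibbs_cmult)
  moreover have "mag J ?V b v = gibbs J ?V b (\<lambda>C. mag J S (\<kappa> C) v)"
  proof -
    have "gibbs J S (\<lambda>x. b x + (\<Sum>y\<in>R. J x y * spin C y)) (\<lambda>A. spin (A \<union> C \<inter> R) v) =
        mag J S (\<kappa> C) v" for C
      by (rule gibbs_cong) (use assms b(2) in \<open>auto simp: \<kappa>_def spin_def\<close>)
    then show ?thesis by (subst gibbs_tower[OF assms(1-3)]) simp
  qed
  ultimately show ?thesis by simp
qed

text \<open>Reveals the spins of \<open>\<Delta>\<close> one at a time, so that no monotone coupling is needed.\<close>

lemma influence_le_sum:
  assumes "finite V" "\<Delta> \<subseteq> V" "\<And>x. x \<in> V \<Longrightarrow> 0 \<le> a x"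
    and B: "\<And>W x. W \<subseteq> V \<Longrightarrow> x \<in> W \<Longrightarrow> mag J W a x \<le> B x"
    and g: "\<And>A. 0 \<le> g A" "\<And>A. g A \<le> 1"
  shows "\<bar>gibbs J V (\<lambda>x. h x + a x) (\<lambda>A. g (A \<inter> \<Delta>)) - gibbs J V (\<lambda>x. h x - a x) (\<lambda>A. g (A \<inter> \<Delta>))\<bar>
    \<le> (\<Sum>x\<in>\<Delta>. B x)"
proof -
  have "finite \<Delta>" using assms(1,2) by (rule rev_finite_subset)
  then show ?thesis using assms
  proof (induction \<Delta> arbitrary: V h g rule: finite_induct)
    case empty
    then show ?case by (simp add: gibbs_const)
  next
    case (insert x \<Delta>)
    define W where "W = V - {x}"
    have V: "V = insert x W" "finite W" "x \<notin> W" "\<Delta> \<subseteq> W" "W \<subseteq> V"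
      using insert.prems insert.hyps by (auto simp: W_def)
    define p where "p = up W (\<lambda>x. h x + a x) x"
    define q where "q = up W (\<lambda>x. h x - a x) x"
    define g1 where "g1 A = g (insert x A)" for A
    define E where "E f k = gibbs J W f (\<lambda>A. k (A \<inter> \<Delta>))" for f k
    have split: "gibbs J V f (\<lambda>A. g (A \<inter> insert x \<Delta>)) =
        up W f x * E (\<lambda>u. f u + J x u) g1 + (1 - up W f x) * E (\<lambda>u. f u - J x u) g" for f
    proof -
      have "gibbs J W f' (\<lambda>A. g (insert x A \<inter> insert x \<Delta>)) = E f' g1" for f'
        unfolding E_def g1_def by (intro gibbs_cong_fun arg_cong[of _ _ g]) auto
      moreover have "gibbs J W f' (\<lambda>A. g (A \<inter> insert x \<Delta>)) = E f' g" for f'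
        unfolding E_def using V(3) by (intro gibbs_cong_fun) (auto intro!: arg_cong[of _ _ g])
      ultimately show ?thesis unfolding V(1) gibbs_split[OF V(2,3)] by simp
    qed
    \<comment> \<open>Pinning \<open>x\<close> changes only \<open>h\<close>, so the induction
      hypothesis applies with the same \<open>a\<close> and \<open>B\<close>.\<close>
    have IH: "\<bar>E (\<lambda>u. f u + a u) k - E (\<lambda>u. f u - a u) k\<bar> \<le> (\<Sum>x\<in>\<Delta>. B x)"
      if "\<And>A. 0 \<le> k A" "\<And>A. k A \<le> 1" for f k
      unfolding E_def by (rule insert.IH) (use V insert.prems that in auto)
    define X1 where "X1 = E (\<lambda>u. (h u + J x u) + a u) g1"
    define X2 where "X2 = E (\<lambda>u. (h u + J x u) - a u) g1"
    define Y1 where "Y1 = E (\<lambda>u. (h u - J x u) + a u) g"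
    define Y2 where "Y2 = E (\<lambda>u. (h u - J x u) - a u) g"
    have XY: "\<bar>X1 - X2\<bar> \<le> (\<Sum>x\<in>\<Delta>. B x)" "\<bar>Y1 - Y2\<bar> \<le> (\<Sum>x\<in>\<Delta>. B x)"
      unfolding X1_def X2_def Y1_def Y2_def using insert.prems by (auto intro!: IH simp: g1_def)
    have "0 \<le> X1" "X1 \<le> 1" "0 \<le> Y1" "Y1 \<le> 1"
      unfolding X1_def Y1_def E_def g1_def using insert.prems V(2)
      by (auto intro!: gibbs_bounds[of W 0 _ 1])
    then have "\<bar>X1 - Y1\<bar> \<le> 1" by simp
    have q: "0 < q" "q < 1" using up_bounds[OF V(2)] by (auto simp: q_def)
    have pq: "0 \<le> p - q" "p - q \<le> B x"
    proof -
      have eq: "2 * (p - q) = mag J V (\<lambda>x. h x + a x) x - mag J V (\<lambda>x. h x - a x) x"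
        unfolding V(1) mag_split_self[OF V(2,3)] p_def q_def by simp
      have "mag J V (\<lambda>x. h x - a x) x \<le> mag J V (\<lambda>x. h x + a x) x"
        using insert.prems(1,3) by (intro mag_mono) (force intro: order_trans[of _ "h _"])+
      then show "0 \<le> p - q" using eq by simp
      have "x \<in> V" using V(1) by simp
      then have "mag J V (\<lambda>x. h x + a x) x - mag J V (\<lambda>x. h x - a x) x \<le> 2 * mag J V a x"
        using insert.prems by (intro influence_le_zero_field) auto
      then show "p - q \<le> B x"
        using insert.prems(4)[OF order_refl \<open>x \<in> V\<close>] eq by simp
    qed
    have "gibbs J V (\<lambda>x. h x + a x) (\<lambda>A. g (A \<inter> insert x \<Delta>)) = p * X1 + (1 - p) * Y1"
      "gibbs J V (\<lambda>x. h x - a x) (\<lambda>A. g (A \<inter> insert x \<Delta>)) = q * X2 + (1 - q) * Y2"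
      unfolding split p_def[symmetric] q_def[symmetric]
      by (simp_all add: X1_def X2_def Y1_def Y2_def algebra_simps)
    \<comment> \<open>As in a coupling: with weight \<open>p - q\<close> the revealed spins at
      \<open>x\<close> differ, and otherwise they agree and the measures pinned alike are
      compared.\<close>
    then have "\<bar>gibbs J V (\<lambda>x. h x + a x) (\<lambda>A. g (A \<inter> insert x \<Delta>)) -
        gibbs J V (\<lambda>x. h x - a x) (\<lambda>A. g (A \<inter> insert x \<Delta>))\<bar> =
        \<bar>(p - q) * (X1 - Y1) + (q * (X1 - X2) + (1 - q) * (Y1 - Y2))\<bar>"
      by (simp add: algebra_simps)
    also have "\<dots> \<le> \<bar>(p - q) * (X1 - Y1)\<bar> + (\<bar>q * (X1 - X2)\<bar> + \<bar>(1 - q) * (Y1 - Y2)\<bar>)"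
      by linarith
    also have "\<dots> \<le> B x * 1 + (q * (\<Sum>x\<in>\<Delta>. B x) + (1 - q) * (\<Sum>x\<in>\<Delta>. B x))"
      unfolding abs_mult using pq q XY \<open>\<bar>X1 - Y1\<bar> \<le> 1\<close>
      by (intro add_mono mult_mono) auto
    also have "\<dots> = (\<Sum>x\<in>insert x \<Delta>. B x)"
      using insert.hyps by (simp add: algebra_simps)
    finally show ?case .
  qed
qed

end

section \<open>Nearest-neighbour couplings on the lattice\<close>

lemma gibbs_reindex:
  assumes "inj_on \<pi> V" "\<And>x y. x \<in> V \<Longrightarrow> y \<in> V \<Longrightarrow> J' (\<pi> x) (\<pi> y) = J x y"
  shows "gibbs J' (\<pi> ` V) f g = gibbs J V (f \<circ> \<pi>) (\<lambda>A. g (\<pi> ` A))"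
proof -
  have bij: "bij_betw ((`) \<pi>) (Pow V) (Pow (\<pi> ` V))"
    using assms(1) by (rule bij_betw_Pow[OF inj_on_imp_bij_betw])
  have energy: "energy J' (\<pi> ` V) f (\<pi> ` A) = energy J V (f \<circ> \<pi>) A" if "A \<subseteq> V" for A
  proof -
    have "spin (\<pi> ` A) (\<pi> x) = spin A x" if "x \<in> V" for x
      using that \<open>A \<subseteq> V\<close> assms(1) by (auto simp: spin_def inj_on_def)
    then show ?thesis
      using assms by (simp add: energy_def sum.reindex cong: sum.cong)
  qed
  have "wsum J' (\<pi> ` V) f k = wsum J V (f \<circ> \<pi>) (\<lambda>A. k (\<pi> ` A))" for k
    unfolding wsum_def sum.reindex_bij_betw[OF bij, symmetric]
    by (intro sum.cong) (simp_all add: energy)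
  then show ?thesis by (simp add: gibbs_def)
qed

lemma l1_norm_zero [simp]: "l1_norm 0 = 0"
  by (simp add: l1_norm_def)

lemma l1_norm_minus: "l1_norm (- x) = l1_norm x"
  by (simp add: l1_norm_def)

lemma l1_norm_commute: "l1_norm (x - y) = l1_norm (y - x)"
  using l1_norm_minus[of "x - y"] by simp

lemma l1_norm_triangle: "l1_norm (x + y) \<le> l1_norm x + l1_norm y"
  unfolding l1_norm_def sum.distrib[symmetric] by (intro sum_mono) (simp add: abs_triangle_ineq)

lemma l1_norm_nonneg: "0 \<le> l1_norm x"
  by (simp add: l1_norm_def sum_nonneg)

lemma l1_dist_triangle: "l1_norm (x - z) \<le> l1_norm (x - y) + l1_norm (y - z)"
  using l1_norm_triangle[of "x - y" "y - z"] by simp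

definition adj :: "int ^ 'd \<Rightarrow> int ^ 'd \<Rightarrow> real" where
  "adj x y = of_bool (l1_norm (x - y) = 1)"

abbreviation (input) nn :: "real \<Rightarrow> int ^ 'd \<Rightarrow> int ^ 'd \<Rightarrow> real" where
  "nn \<beta> \<equiv> \<lambda>x y. \<beta> * adj x y"

definition bdry_degree :: "(int ^ 'd) set \<Rightarrow> int ^ 'd \<Rightarrow> real" where
  "bdry_degree S x = (\<Sum>y\<in>ext_boundary S. adj x y)"

text \<open>The quantity \<open>\<phi>\<^sub>\<beta>(S)\<close> of Duminil-Copin and Tassion, with \<open>\<beta>\<close> in place of \<open>tanh \<beta>\<close>.\<close>

definition dct_phi :: "real \<Rightarrow> (int ^ 'd) set \<Rightarrow> int ^ 'd \<Rightarrow> real" where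
  "dct_phi \<beta> S v = \<beta> * (\<Sum>x\<in>S. corr (nn \<beta>) S v x * bdry_degree S x)"

lemma adj_commute: "adj x y = adj y x"
  by (simp add: adj_def l1_norm_commute)

lemma adj_nonneg: "0 \<le> adj x y"
  by (simp add: adj_def)

lemma ferromagnet_nn: "0 \<le> \<beta> \<Longrightarrow> ferromagnet (nn \<beta>)"
  by (simp add: ferromagnet_def adj_commute adj_nonneg) (simp add: adj_def)

lemma ferromagnet_adj: "ferromagnet adj"
  using ferromagnet_nn[of 1] by simp

lemma adj_outside: "x \<in> S \<Longrightarrow> y \<notin> S \<Longrightarrow> adj x y \<noteq> 0 \<Longrightarrow> y \<in> ext_boundary S"
  by (auto simp: adj_def ext_boundary_def l1_norm_commute[of x])

lemma bdry_degree_nonneg: "0 \<le> bdry_degree S x"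
  by (simp add: bdry_degree_def sum_nonneg adj_nonneg)

lemma ext_boundary_translate: "ext_boundary ((+) v ` S) = (+) v ` ext_boundary S"
proof -
  have sub: "(+) v ` ext_boundary S \<subseteq> ext_boundary ((+) v ` S)" for v and S :: "(int ^ 'd) set"
    by (auto simp: ext_boundary_def)
  have "(+) v ` (+) (- v) ` T = T" "(+) (- v) ` (+) v ` T = T" for T
    by (simp_all add: image_image)
  then show ?thesis using sub[of v S] sub[of "- v" "(+) v ` S"]
    by (metis image_mono subset_antisym)
qed

lemma dct_phi_translate: "dct_phi \<beta> ((+) v ` S) v = dct_phi \<beta> S 0"
proof -
  have "corr (nn \<beta>) ((+) v ` S) v (v + x) = corr (nn \<beta>) S 0 x" for x
  proof -
    have "spin ((+) v ` A) (v + z) = spin A z" for A z by (auto simp: spin_def)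
    from this[of _ 0] this[of _ x] show ?thesis
      by (subst gibbs_reindex[where J = "nn \<beta>"]) (simp_all add: adj_def comp_def)
  qed
  moreover have "bdry_degree ((+) v ` S) (v + x) = bdry_degree S x" for x
    by (simp add: bdry_degree_def ext_boundary_translate sum.reindex adj_def)
  ultimately show ?thesis by (simp add: dct_phi_def sum.reindex)
qed

text \<open>Simon-Lieb for the translate of \<open>S0\<close> to \<open>x\<close>, cut down to
  \<open>V\<close>, gains one factor \<open>dct_phi \<beta> S0 0\<close> and leads to vertices at
  most \<open>L + 1\<close> nearer to \<open>y\<close>.\<close>

lemma mag_decay:
  fixes V S0 :: "(int ^ 'd) set"
  assumes \<beta>: "0 \<le> \<beta>" and V: "finite V" and S0: "finite S0" "0 \<in> S0" "\<And>z. z \<in> S0 \<Longrightarrow> l1_norm z \<le> int L"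
  shows "x \<in> V \<Longrightarrow> int k * (int L + 1) + 1 \<le> l1_norm (x - y) \<Longrightarrow>
    mag (nn \<beta>) V (nn \<beta> y) x \<le> dct_phi \<beta> S0 0 ^ k"
proof (induction k arbitrary: x)
  case 0
  then show ?case using V by (simp add: mag_le_1)
next
  case (Suc k)
  interpret ferromagnet "nn \<beta>" by (rule ferromagnet_nn) fact
  define U where "U = (+) x ` S0"
  define S where "S = V \<inter> U"
  define R where "R = V - U"
  define m where "m = mag (nn \<beta>) V (nn \<beta> y)"
  have U: "finite U" "x \<in> U" using S0 by (auto simp: U_def image_iff)
  have VSR: "V = S \<union> R" "finite S" "finite R" "S \<inter> R = {}" "x \<in> S"
    using V U Suc.prems by (auto simp: S_def R_def)
  have far: "int k * (int L + 1) + 2 \<le> l1_norm (z - y)" if "z \<in> S" for z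
  proof -
    have "l1_norm (x - z) \<le> int L"
      using that S0(3) by (auto simp: S_def U_def l1_norm_minus)
    then show ?thesis
      using Suc.prems(2) l1_dist_triangle[of x y z] by (simp add: algebra_simps)
  qed
  \<comment> \<open>All of \<open>S\<close> has distance at least 2 from \<open>y\<close>, so the
    field \<open>nn \<beta> y\<close> vanishes there, as Simon-Lieb requires.\<close>
  have "0 \<le> int k * (int L + 1)" by simp
  then have zero: "nn \<beta> y z = 0" if "z \<in> S" for z
  proof -
    have "l1_norm (z - y) \<noteq> 1" using far[OF that] \<open>0 \<le> int k * (int L + 1)\<close> by linarith
    then show ?thesis by (simp add: adj_def l1_norm_commute[of y])
  qed
  have step: "adj z w * m w \<le> adj z w * dct_phi \<beta> S0 0 ^ k" if "z \<in> S" "w \<in> R" for z w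
  proof (cases "l1_norm (z - w) = 1")
    case True
    have "int k * (int L + 1) + 1 \<le> l1_norm (w - y)"
      using far[OF that(1)] l1_dist_triangle[of z y w] True by simp
    then have "m w \<le> dct_phi \<beta> S0 0 ^ k"
      unfolding m_def using that by (intro Suc.IH) (auto simp: R_def)
    then show ?thesis by (intro mult_left_mono adj_nonneg)
  qed (simp add: adj_def)
  have phi_nonneg: "0 \<le> dct_phi \<beta> S0 0"
    unfolding dct_phi_def using S0 \<beta>
    by (intro mult_nonneg_nonneg sum_nonneg corr_nonneg bdry_degree_nonneg) auto
  have "m x \<le> (\<Sum>z\<in>S. corr (nn \<beta>) S x z * (\<Sum>w\<in>R. nn \<beta> z w * m w))"
    unfolding m_def VSR(1) using zero VSR(2-)
    by (intro simon_lieb) (auto intro!: mult_nonneg_nonneg \<beta> adj_nonneg)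
  \<comment> \<open>Correlations in \<open>S\<close> are replaced by those in the full translate
    \<open>U\<close>, so that the factor does not depend on \<open>V\<close>.\<close>
  also have "\<dots> \<le> (\<Sum>z\<in>S. corr (nn \<beta>) U x z * (\<beta> * (bdry_degree U z * dct_phi \<beta> S0 0 ^ k)))"
  proof (intro sum_mono mult_mono)
    fix z assume z: "z \<in> S"
    show "corr (nn \<beta>) S x z \<le> corr (nn \<beta>) U x z"
      using z VSR(5) by (intro corr_domain_mono U) (auto simp: S_def)
    show "0 \<le> corr (nn \<beta>) U x z"
      using z U by (intro corr_nonneg) (auto simp: S_def)
    have "(\<Sum>w\<in>R. adj z w * m w) \<le> (\<Sum>w\<in>R. adj z w * dct_phi \<beta> S0 0 ^ k)"
      by (intro sum_mono step z)
    also have "\<dots> = (\<Sum>w\<in>R. adj z w) * dct_phi \<beta> S0 0 ^ k"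
      by (simp add: sum_distrib_right)
    also have "\<dots> \<le> bdry_degree U z * dct_phi \<beta> S0 0 ^ k"
    proof (intro mult_right_mono)
      have "(\<Sum>w\<in>R. adj z w) = (\<Sum>w\<in>R \<inter> ext_boundary U. adj z w)"
        using VSR(3) z adj_outside[of z U] by (intro sum.mono_neutral_right) (auto simp: S_def R_def)
      also have "\<dots> \<le> bdry_degree U z"
        unfolding bdry_degree_def
        by (intro sum_mono2 finite_ext_boundary U) (auto simp: adj_nonneg)
      finally show "(\<Sum>w\<in>R. adj z w) \<le> bdry_degree U z" .
    qed (use phi_nonneg in simp)
    finally show "(\<Sum>w\<in>R. nn \<beta> z w * m w) \<le> \<beta> * (bdry_degree U z * dct_phi \<beta> S0 0 ^ k)"
      using \<beta> by (simp add: mult.assoc mult_left_mono flip: sum_distrib_left)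
    show "0 \<le> (\<Sum>w\<in>R. nn \<beta> z w * m w)"
      unfolding m_def using \<beta> V adj_nonneg
      by (intro sum_nonneg mult_nonneg_nonneg mag_nonneg) (auto simp: R_def)
  qed
  also have "\<dots> \<le> (\<Sum>z\<in>U. corr (nn \<beta>) U x z * (\<beta> * (bdry_degree U z * dct_phi \<beta> S0 0 ^ k)))"
    using U \<beta> phi_nonneg
    by (intro sum_mono2 mult_nonneg_nonneg corr_nonneg bdry_degree_nonneg) (auto simp: S_def)
  also have "\<dots> = dct_phi \<beta> U x * dct_phi \<beta> S0 0 ^ k"
    by (simp add: dct_phi_def sum_distrib_left sum_distrib_right mult_ac)
  also have "\<dots> = dct_phi \<beta> S0 0 ^ Suc k"
    by (simp add: U_def dct_phi_translate)
  finally show ?case by (simp add: m_def)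
qed

section \<open>The differential inequality for the plus magnetization\<close>

definition plus_mag :: "(int ^ 'd) set \<Rightarrow> real \<Rightarrow> int ^ 'd \<Rightarrow> real" where
  "plus_mag V \<beta> v = mag (nn \<beta>) V (\<lambda>x. \<beta> * bdry_degree V x) v"

lemma plus_mag_has_derivative:
  assumes "finite V"
  shows "((\<lambda>\<beta>. plus_mag V \<beta> v) has_real_derivative
    gcov (nn \<beta>) V (\<lambda>x. \<beta> * bdry_degree V x) (\<lambda>A. spin A v) (energy adj V (bdry_degree V))) (at \<beta>)"
  using gibbs_has_derivative[OF assms, of "\<lambda>_ _. 0" adj "\<lambda>_. 0" "bdry_degree V" "\<lambda>A. spin A v" \<beta>]
  by (simp add: plus_mag_def)

text \<open>\<open>gcov_energy_ge\<close> with \<open>w = v\<close> and constant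
  \<open>1 / \<beta>0\<close>; the variance of a spin is 1 minus its squared mean. The hypothesis at
  \<open>\<beta>0\<close> serves larger \<open>\<beta>\<close> because correlations increase, and an
  edge leaving \<open>S\<close> ends in \<open>V - S\<close> or in
  \<open>ext_boundary V\<close>.\<close>

lemma plus_mag_derivative_ge:
  assumes V: "finite V" "v \<in> V" and \<beta>: "0 < \<beta>0" "\<beta>0 \<le> \<beta>"
    and phi: "\<And>S. finite S \<Longrightarrow> v \<in> S \<Longrightarrow> 1 \<le> dct_phi \<beta>0 S v"
  shows "(1 - (plus_mag V \<beta> v)\<^sup>2) / \<beta>0 \<le>
    gcov (nn \<beta>) V (\<lambda>x. \<beta> * bdry_degree V x) (\<lambda>A. spin A v) (energy adj V (bdry_degree V))"
proof -
  interpret ferromagnet "nn \<beta>" by (rule ferromagnet_nn) (use \<beta> in simp)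
  have "1 / \<beta>0 \<le> (\<Sum>x\<in>S. corr (nn \<beta>) S v x * ((\<Sum>y\<in>V - S. adj x y) + bdry_degree V x))"
    if S: "S \<subseteq> V" "v \<in> S" for S
  proof -
    have finS: "finite S" using S V finite_subset by blast
    have "1 / \<beta>0 \<le> (\<Sum>x\<in>S. corr (nn \<beta>0) S v x * bdry_degree S x)"
      using phi[OF finS S(2)] \<beta> by (simp add: dct_phi_def divide_le_eq mult.commute)
    also have "\<dots> \<le> (\<Sum>x\<in>S. corr (nn \<beta>) S v x * ((\<Sum>y\<in>V - S. adj x y) + bdry_degree V x))"
    proof (intro sum_mono mult_mono)
      fix x assume x: "x \<in> S"
      show "corr (nn \<beta>0) S v x \<le> corr (nn \<beta>) S v x"
        using \<beta> S x finS by (intro corr_mono_coupling ferromagnet_nn) (auto intro: mult_right_mono adj_nonneg)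
      show "0 \<le> corr (nn \<beta>) S v x" using S x finS by (intro corr_nonneg)
      have "bdry_degree S x \<le> (\<Sum>y\<in>(V - S) \<union> ext_boundary V. adj x y)"
        unfolding bdry_degree_def
      proof (intro sum_mono2)
        show "finite (V - S \<union> ext_boundary V)" using V by (simp add: finite_ext_boundary)
      qed (use S(1) in \<open>auto simp: adj_nonneg ext_boundary_def\<close>)
      also have "\<dots> = (\<Sum>y\<in>V - S. adj x y) + bdry_degree V x"
        unfolding bdry_degree_def using V
        by (intro sum.union_disjoint finite_ext_boundary) (auto simp: ext_boundary_def)
      finally show "bdry_degree S x \<le> \<dots>" .
    qed (rule bdry_degree_nonneg)
    finally show ?thesis .
  qed
  then have "1 / \<beta>0 * gcov (nn \<beta>) V (\<lambda>x. \<beta> * bdry_degree V x) (\<lambda>A. spin A v) (\<lambda>A. spin A v) \<le>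
    gcov (nn \<beta>) V (\<lambda>x. \<beta> * bdry_degree V x) (\<lambda>A. spin A v) (energy adj V (bdry_degree V))"
    using V \<beta> by (intro gcov_energy_ge ferromagnet_adj) (auto simp: bdry_degree_nonneg)
  then show ?thesis
    using V by (simp add: gcov_def gibbs_const plus_mag_def power2_eq_square)
qed

text \<open>By the mean value theorem, since the magnetization at the intermediate point is at most
  that at \<open>\<beta>\<close>. The prefactor does not depend on \<open>V\<close>, which excludes
  a vanishing limit.\<close>

lemma plus_mag_lower_bound:
  assumes V: "finite V" "v \<in> V" and \<beta>: "0 < \<beta>0" "\<beta>0 < \<beta>"
    and phi: "\<And>S. finite S \<Longrightarrow> v \<in> S \<Longrightarrow> 1 \<le> dct_phi \<beta>0 S v"
  shows "(\<beta> - \<beta>0) / \<beta>0 * (1 - (plus_mag V \<beta> v)\<^sup>2) \<le> plus_mag V \<beta> v"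
proof -
  define D where "D t = gcov (nn t) V (\<lambda>x. t * bdry_degree V x) (\<lambda>A. spin A v)
    (energy adj V (bdry_degree V))" for t
  have deriv: "((\<lambda>t. plus_mag V t v) has_real_derivative D t) (at t)" for t
    unfolding D_def by (rule plus_mag_has_derivative) fact
  have bounds: "0 \<le> plus_mag V t v" "plus_mag V t v \<le> 1" if "0 \<le> t" for t
    unfolding plus_mag_def using V that
    by (auto intro!: ferromagnet.mag_nonneg ferromagnet_nn mag_le_1 mult_nonneg_nonneg bdry_degree_nonneg)
  obtain \<xi> where \<xi>: "\<beta>0 < \<xi>" "\<xi> < \<beta>"
    "plus_mag V \<beta> v - plus_mag V \<beta>0 v = (\<beta> - \<beta>0) * D \<xi>"
    using MVT2[OF \<beta>(2), of "\<lambda>t. plus_mag V t v" D] deriv by blast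
  have "plus_mag V \<xi> v \<le> plus_mag V \<beta> v"
    unfolding plus_mag_def using V \<beta> \<xi>
    by (intro mag_mono_coupling ferromagnet_nn)
      (auto intro!: mult_right_mono mult_nonneg_nonneg bdry_degree_nonneg adj_nonneg)
  then have "(plus_mag V \<xi> v)\<^sup>2 \<le> (plus_mag V \<beta> v)\<^sup>2"
    using bounds(1)[of \<xi>] \<xi> \<beta> by (intro power_mono) auto
  then have "(1 - (plus_mag V \<beta> v)\<^sup>2) / \<beta>0 \<le> (1 - (plus_mag V \<xi> v)\<^sup>2) / \<beta>0"
    using \<beta> by (intro divide_right_mono) auto
  also have "\<dots> \<le> D \<xi>"
    unfolding D_def using \<xi> by (intro plus_mag_derivative_ge V \<beta> phi) auto
  finally have "(\<beta> - \<beta>0) * ((1 - (plus_mag V \<beta> v)\<^sup>2) / \<beta>0) \<le> (\<beta> - \<beta>0) * D \<xi>"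
    using \<beta> by (intro mult_left_mono) auto
  then show ?thesis using \<xi>(3) bounds(1)[of \<beta>0] \<beta> by simp
qed

lemma exists_dct_phi_less_1:
  fixes V :: "nat \<Rightarrow> (int ^ 'd) set"
  assumes "\<And>N. finite (V N)" "\<And>N. 0 \<in> V N" "0 \<le> \<beta>0" "\<beta>0 < \<beta>"
    and lim: "(\<lambda>N. plus_mag (V N) \<beta> 0) \<longlonglongrightarrow> 0"
  shows "\<exists>S. finite S \<and> 0 \<in> S \<and> dct_phi \<beta>0 S (0 :: int ^ 'd) < 1"
proof (rule ccontr)
  assume "\<not> ?thesis"
  then have phi: "1 \<le> dct_phi \<beta>0 S 0" if "finite S" "0 \<in> S" for S :: "(int ^ 'd) set"
    using that by (meson not_le)
  \<comment> \<open>At inverse temperature 0 every \<open>dct_phi\<close> vanishes; the bound below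
    divides by \<open>\<beta>0\<close>.\<close>
  have "\<beta>0 \<noteq> 0" using phi[of "{0}"] by (auto simp: dct_phi_def)
  then have "(\<beta> - \<beta>0) / \<beta>0 * (1 - (plus_mag (V N) \<beta> 0)\<^sup>2) \<le> plus_mag (V N) \<beta> 0" for N
    using assms phi by (intro plus_mag_lower_bound) auto
  moreover have "(\<lambda>N. (\<beta> - \<beta>0) / \<beta>0 * (1 - (plus_mag (V N) \<beta> 0)\<^sup>2)) \<longlonglongrightarrow>
      (\<beta> - \<beta>0) / \<beta>0 * (1 - 0\<^sup>2)"
    by (intro tendsto_intros lim)
  ultimately have "(\<beta> - \<beta>0) / \<beta>0 * (1 - 0\<^sup>2) \<le> 0"
    using lim by (intro LIMSEQ_le) auto
  moreover have "0 < (\<beta> - \<beta>0) / \<beta>0" using assms \<open>\<beta>0 \<noteq> 0\<close> by (intro divide_pos_pos) auto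
  ultimately show False by simp
qed

section \<open>Ising measures\<close>

text \<open>Each edge is counted through its two orientations. Pairs inside \<open>V\<close> keep
  the factor 1/2, while the two equal orientations of a boundary edge compensate it.\<close>

lemma ising_edges_sum:
  fixes V :: "(int ^ 'd) set"
  assumes "finite V"
  shows "(\<Sum>e\<in>ising_edges V. \<Prod>x\<in>e. g x) =
    (\<Sum>x\<in>V. \<Sum>y\<in>V. adj x y * (g x * g y)) / 2 +
    (\<Sum>x\<in>V. \<Sum>y\<in>ext_boundary V. adj x y * (g x * (g y :: real)))"
proof -
  define D where "D = ext_boundary V"
  define U where "U = V \<union> D"
  define F where "F x y = of_bool (x \<in> V \<or> y \<in> V) * (adj x y * (g x * g y))" for x y
  define P where "P = {p \<in> U \<times> U. (fst p \<in> V \<or> snd p \<in> V) \<and> l1_norm (fst p - snd p) = 1}"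
  have fin: "finite D" "finite U" "V \<inter> D = {}"
    using assms finite_ext_boundary by (auto simp: U_def D_def ext_boundary_def)
  then have finP: "finite P" by (auto simp: P_def)
  have edges: "ising_edges V = (\<lambda>p. {fst p, snd p}) ` P"
  proof (intro subset_antisym subsetI)
    fix e assume "e \<in> ising_edges V"
    then obtain x y where "(x, y) \<in> P" "e = {x, y}"
      unfolding ising_edges_def P_def U_def D_def by auto
    then show "e \<in> (\<lambda>p. {fst p, snd p}) ` P" by force
  next
    fix e assume "e \<in> (\<lambda>p. {fst p, snd p}) ` P"
    then obtain x y where "(x, y) \<in> P" "e = {x, y}" by auto
    then show "e \<in> ising_edges V"
      unfolding ising_edges_def P_def U_def D_def mem_Collect_eq by (intro exI[of _ x] exI[of _ y]) auto
  qed
  have "(\<Sum>p\<in>P. g (fst p) * g (snd p)) =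
      (\<Sum>e\<in>ising_edges V. \<Sum>p\<in>{p \<in> P. {fst p, snd p} = e}. g (fst p) * g (snd p))"
    using finP by (intro sum.group[symmetric]) (auto simp: edges)
  also have "\<dots> = (\<Sum>e\<in>ising_edges V. 2 * (\<Prod>x\<in>e. g x))"
  proof (rule sum.cong[OF refl])
    fix e assume "e \<in> ising_edges V"
    then obtain x y where xy: "(x, y) \<in> P" "e = {x, y}" unfolding edges by auto
    then have neq: "x \<noteq> y" by (auto simp: P_def)
    have "(y, x) \<in> P" using xy(1) by (auto simp: P_def l1_norm_commute[of y])
    then have "{p \<in> P. {fst p, snd p} = e} = {(x, y), (y, x)}"
      using xy by (auto simp: doubleton_eq_iff)
    then show "(\<Sum>p\<in>{p \<in> P. {fst p, snd p} = e}. g (fst p) * g (snd p)) = 2 * (\<Prod>x\<in>e. g x)"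
      using neq xy(2) by simp
  qed
  finally have "2 * (\<Sum>e\<in>ising_edges V. \<Prod>x\<in>e. g x) = (\<Sum>p\<in>P. g (fst p) * g (snd p))"
    by (simp add: sum_distrib_left)
  also have "\<dots> = (\<Sum>p\<in>U \<times> U. F (fst p) (snd p))"
    unfolding P_def using fin by (subst sum.inter_filter) (auto simp: F_def adj_def intro!: sum.cong)
  also have "\<dots> = (\<Sum>x\<in>U. \<Sum>y\<in>U. F x y)"
    by (simp add: sum.cartesian_product case_prod_unfold)
  also have "\<dots> = (\<Sum>x\<in>V. \<Sum>y\<in>V. F x y) + (\<Sum>x\<in>V. \<Sum>y\<in>D. F x y) +
      ((\<Sum>x\<in>D. \<Sum>y\<in>V. F x y) + (\<Sum>x\<in>D. \<Sum>y\<in>D. F x y))"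
    unfolding U_def using fin assms by (simp add: sum.union_disjoint sum.distrib)
  also have "(\<Sum>x\<in>D. \<Sum>y\<in>D. F x y) = 0"
    using fin(3) by (intro sum.neutral ballI) (auto simp: F_def)
  also have "(\<Sum>x\<in>D. \<Sum>y\<in>V. F x y) = (\<Sum>x\<in>V. \<Sum>y\<in>D. F x y)"
    by (subst sum.swap) (simp add: F_def adj_commute mult.commute disj_commute)
  finally show ?thesis
    by (simp add: F_def D_def)
qed

text \<open>Absorbs the boundary spins into the field, so that the Ising measure becomes a Gibbs
  measure on the plus sets in \<open>V\<close>.\<close>

definition eff_field ::
    "(int ^ 'd) set \<Rightarrow> real \<Rightarrow> (int ^ 'd \<Rightarrow> real) \<Rightarrow> (int ^ 'd \<Rightarrow> real) \<Rightarrow> int ^ 'd \<Rightarrow> real" where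
  "eff_field V \<beta> h \<tau> x = h x + \<beta> * (\<Sum>y\<in>ext_boundary V. adj x y * \<tau> y)"

lemma ising_weight_eq:
  assumes "finite V"
  shows "ising_weight V \<beta> h \<tau> (restrict (spin A) V) = exp (energy (nn \<beta>) V (eff_field V \<beta> h \<tau>) A)"
proof -
  let ?g = "glue_spins V \<tau> (restrict (spin A) V)"
  define T where "T x = (\<Sum>y\<in>ext_boundary V. adj x y * \<tau> y)" for x
  define Q where "Q = (\<Sum>x\<in>V. \<Sum>y\<in>V. adj x y * (spin A x * spin A y))"
  have "(\<Sum>x\<in>V. \<Sum>y\<in>V. adj x y * (?g x * ?g y)) = Q"
    unfolding Q_def by (intro sum.cong refl) (auto simp: glue_spins_def)
  moreover have "(\<Sum>x\<in>V. \<Sum>y\<in>ext_boundary V. adj x y * (?g x * ?g y)) = (\<Sum>x\<in>V. T x * spin A x)"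
    unfolding T_def sum_distrib_right by (intro sum.cong refl) (auto simp: glue_spins_def ext_boundary_def)
  moreover have "(\<Sum>x\<in>V. h x * restrict (spin A) V x) = (\<Sum>x\<in>V. h x * spin A x)"
    by (intro sum.cong refl) simp
  moreover have "(\<Sum>x\<in>V. \<Sum>y\<in>V. nn \<beta> x y * (spin A x * spin A y)) = \<beta> * Q"
    by (simp add: Q_def sum_distrib_left mult.assoc)
  moreover have "(\<Sum>x\<in>V. (h x + \<beta> * T x) * spin A x) =
      (\<Sum>x\<in>V. h x * spin A x) + \<beta> * (\<Sum>x\<in>V. T x * spin A x)"
    by (simp add: distrib_right sum.distrib sum_distrib_left mult.assoc)
  ultimately show ?thesis
    unfolding ising_weight_def ising_edges_sum[OF assms] energy_def eff_field_def T_def[symmetric]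
    by (simp only: distrib_left) simp
qed

lemma bij_betw_spin_configs: "bij_betw (\<lambda>A. restrict (spin A) V) (Pow V) (spin_configs V)"
proof (rule bij_betw_byWitness[where f' = "\<lambda>\<sigma>. {x \<in> V. \<sigma> x = 1}"])
  show "\<forall>\<sigma>\<in>spin_configs V. restrict (spin {x \<in> V. \<sigma> x = 1}) V = \<sigma>"
  proof (intro ballI ext)
    fix \<sigma> x assume \<sigma>: "\<sigma> \<in> spin_configs V"
    show "restrict (spin {x \<in> V. \<sigma> x = 1}) V x = \<sigma> x"
    proof (cases "x \<in> V")
      case True
      then have "\<sigma> x = -1 \<or> \<sigma> x = 1" using \<sigma> by (auto simp: spin_configs_def)
      then show ?thesis using True by (auto simp: spin_def)
    next
      case False
      then show ?thesis using PiE_arb[OF \<sigma>[unfolded spin_configs_def]] by simp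
    qed
  qed
qed (auto simp: spin_configs_def spin_def split: if_splits)

lemma spin_configs_sum:
  "(\<Sum>\<sigma>\<in>spin_configs V. F \<sigma>) = (\<Sum>A\<in>Pow V. F (restrict (spin A) V))"
  by (rule sum.reindex_bij_betw[OF bij_betw_spin_configs, symmetric])

lemma integral_ising_measure:
  fixes F :: "(int ^ 'd \<Rightarrow> real) \<Rightarrow> real"
  assumes "finite V"
  shows "(\<integral>\<sigma>. F \<sigma> \<partial>ising_measure V \<beta> h \<tau>) =
    gibbs (nn \<beta>) V (eff_field V \<beta> h \<tau>) (\<lambda>A. F (restrict (spin A) V))"
proof -
  define f where "f = eff_field V \<beta> h \<tau>"
  have Z: "ising_partition_function V \<beta> h \<tau> = pfun (nn \<beta>) V f"
    unfolding ising_partition_function_def wsum_def spin_configs_sum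
    by (simp add: ising_weight_eq[OF assms] f_def)
  have "(\<integral>\<sigma>. F \<sigma> \<partial>ising_measure V \<beta> h \<tau>) =
      (\<Sum>\<sigma>\<in>spin_configs V. ising_weight V \<beta> h \<tau> \<sigma> / pfun (nn \<beta>) V f * F \<sigma>)"
    unfolding ising_measure_def Z
    using pfun_pos[OF assms, of "nn \<beta>" f]
    by (subst lebesgue_integral_point_measure_finite)
       (auto simp: finite_spin_configs assms ising_weight_def)
  also have "\<dots> = gibbs (nn \<beta>) V f (\<lambda>A. F (restrict (spin A) V))"
    unfolding spin_configs_sum gibbs_def
    by (subst wsum_def) (simp add: ising_weight_eq[OF assms] f_def sum_divide_distrib)
  finally show ?thesis by (simp add: f_def)
qed

lemma plus_magnetization_eq:
  "plus_magnetization TYPE('d::finite) N \<beta> = plus_mag (lattice_box N) \<beta> (0 :: int ^ 'd)"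
proof -
  define \<Lambda> where "\<Lambda> = (lattice_box N :: (int ^ 'd) set)"
  have 0: "finite \<Lambda>" "0 \<in> \<Lambda>" by (auto simp: \<Lambda>_def finite_lattice_box) (simp add: lattice_box_def)
  have "eff_field \<Lambda> \<beta> (\<lambda>_. 0) (\<lambda>x\<in>ext_boundary \<Lambda>. 1) = (\<lambda>x. \<beta> * bdry_degree \<Lambda> x)"
    by (simp add: eff_field_def bdry_degree_def fun_eq_iff)
  then show ?thesis
    using 0 by (simp add: plus_magnetization_def Let_def integral_ising_measure plus_mag_def flip: \<Lambda>_def)
qed

text \<open>The form \<open>A \<inter> \<Delta>\<close> matches the observables in
  \<open>influence_le_sum\<close>.\<close>

lemma measure_marginal:
  assumes "finite V" "\<Delta> \<subseteq> V" "X \<subseteq> spin_configs \<Delta>"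
  shows "measure (marginal (ising_measure V \<beta> h \<tau>) \<Delta>) X =
    gibbs (nn \<beta>) V (eff_field V \<beta> h \<tau>) (\<lambda>A. indicator X (restrict (spin (A \<inter> \<Delta>)) \<Delta>))"
proof -
  define M where "M = ising_measure V \<beta> h \<tau>"
  have space: "space M = spin_configs V" by (simp add: M_def ising_measure_def space_point_measure)
  have sub: "restrict \<sigma> \<Delta> \<in> spin_configs \<Delta>" if "\<sigma> \<in> spin_configs V" for \<sigma>
    using that assms(2) by (auto simp: spin_configs_def)
  have "(\<lambda>\<sigma>. restrict \<sigma> \<Delta>) \<in> measurable M (count_space (spin_configs \<Delta>))"
    using sub by (simp add: M_def ising_measure_def)
  then have "measure (marginal M \<Delta>) X = measure M ((\<lambda>\<sigma>. restrict \<sigma> \<Delta>) -` X \<inter> space M)"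
    unfolding marginal_def using assms(3) by (intro measure_distr) auto
  also have "\<dots> = (\<integral>\<sigma>. indicator ((\<lambda>\<sigma>. restrict \<sigma> \<Delta>) -` X) \<sigma> \<partial>M)"
    by (rule Bochner_Integration.integral_indicator[symmetric])
  also have "\<dots> = gibbs (nn \<beta>) V (eff_field V \<beta> h \<tau>)
      (\<lambda>A. indicator ((\<lambda>\<sigma>. restrict \<sigma> \<Delta>) -` X) (restrict (spin A) V))"
    unfolding M_def by (rule integral_ising_measure) fact
  also have "\<dots> = gibbs (nn \<beta>) V (eff_field V \<beta> h \<tau>) (\<lambda>A. indicator X (restrict (spin (A \<inter> \<Delta>)) \<Delta>))"
  proof (rule gibbs_cong_fun)
    fix A
    have "restrict (restrict (spin A) V) \<Delta> = restrict (spin (A \<inter> \<Delta>)) \<Delta>"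
      using assms(2) by (auto simp: fun_eq_iff spin_def)
    then show "indicator ((\<lambda>\<sigma>. restrict \<sigma> \<Delta>) -` X) (restrict (spin A) V) =
        (indicator X (restrict (spin (A \<inter> \<Delta>)) \<Delta>) :: real)"
      by (simp add: indicator_def)
  qed
  finally show ?thesis by (simp add: M_def)
qed

lemma tv_marginal_le:
  fixes V \<Delta> :: "(int ^ 'd) set"
  assumes V: "finite V" "\<Delta> \<subseteq> V" and y: "y \<in> ext_boundary V" and \<beta>: "0 \<le> \<beta>"
    and \<tau>: "\<tau> \<in> spin_configs (ext_boundary V)"
    and B: "\<And>W x. finite W \<Longrightarrow> x \<in> W \<Longrightarrow> mag (nn \<beta>) W (nn \<beta> y) x \<le> B x"
  shows "tv_dist (marginal (ising_measure V \<beta> h \<tau>) \<Delta>) (marginal (ising_measure V \<beta> h (flip_spin \<tau> y)) \<Delta>)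
    \<le> (\<Sum>x\<in>\<Delta>. B x)"
  unfolding tv_dist_def
proof (rule cSUP_least)
  interpret ferromagnet "nn \<beta>" by (rule ferromagnet_nn) fact
  fix X assume "X \<in> sets (marginal (ising_measure V \<beta> h \<tau>) \<Delta>)"
  then have X: "X \<subseteq> spin_configs \<Delta>" by (simp add: marginal_def)
  define g :: "(int ^ 'd) set \<Rightarrow> real" where "g A = indicator X (restrict (spin A) \<Delta>)" for A
  \<comment> \<open>The effective field without the contribution of \<open>y\<close>. The two
    boundary conditions add and subtract the same nonnegative field, in an order given by the sign
    of \<open>\<tau> y\<close>.\<close>
  define k where "k x = eff_field V \<beta> h \<tau> x - nn \<beta> y x * \<tau> y" for x
  define G where "G f = gibbs (nn \<beta>) V f (\<lambda>A. g (A \<inter> \<Delta>))" for f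
  have fin: "finite (ext_boundary V)" using V by (simp add: finite_ext_boundary)
  have field: "eff_field V \<beta> h \<tau> = (\<lambda>x. k x + nn \<beta> y x * \<tau> y)" by (simp add: k_def)
  have flip_sum: "(\<Sum>z\<in>ext_boundary V. adj x z * flip_spin \<tau> y z) =
      (\<Sum>z\<in>ext_boundary V. adj x z * \<tau> z) - 2 * (adj y x * \<tau> y)" for x
    using fin y
    by (simp add: sum.remove[OF fin y] flip_spin_def adj_commute[of y])
  have flip: "eff_field V \<beta> h (flip_spin \<tau> y) = (\<lambda>x. k x - nn \<beta> y x * \<tau> y)"
    by (rule ext, unfold eff_field_def k_def flip_sum) (simp add: algebra_simps)
  have "\<bar>G (\<lambda>x. k x + nn \<beta> y x) - G (\<lambda>x. k x - nn \<beta> y x)\<bar> \<le> (\<Sum>x\<in>\<Delta>. B x)"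
    unfolding G_def using V \<beta> B finite_subset[OF _ V(1)]
    by (intro influence_le_sum) (auto simp: g_def adj_nonneg indicator_def)
  moreover have "\<tau> y = 1 \<or> \<tau> y = -1" using \<tau> y by (auto simp: spin_configs_def)
  ultimately have "\<bar>G (\<lambda>x. k x + nn \<beta> y x * \<tau> y) - G (\<lambda>x. k x - nn \<beta> y x * \<tau> y)\<bar> \<le> (\<Sum>x\<in>\<Delta>. B x)"
    by (auto simp: abs_minus_commute)
  then show "\<bar>measure (marginal (ising_measure V \<beta> h \<tau>) \<Delta>) X -
      measure (marginal (ising_measure V \<beta> h (flip_spin \<tau> y)) \<Delta>) X\<bar> \<le> (\<Sum>x\<in>\<Delta>. B x)"
    unfolding measure_marginal[OF V X] field flip G_def g_def .
qed (auto intro: sets.empty_sets)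

lemma mag_exponential_decay:
  fixes S0 :: "(int ^ 'd) set"
  assumes \<beta>: "0 \<le> \<beta>" and S0: "finite S0" "0 \<in> S0" "dct_phi \<beta> S0 0 < 1"
  shows "\<exists>C m. 0 < C \<and> 0 < m \<and> (\<forall>V (x :: int ^ 'd) y. finite V \<longrightarrow> x \<in> V \<longrightarrow>
    mag (nn \<beta>) V (nn \<beta> y) x \<le> C * exp (- m * real_of_int (l1_norm (x - y))))"
proof -
  interpret ferromagnet "nn \<beta>" by (rule ferromagnet_nn) fact
  define L where "L = nat (Max (l1_norm ` S0))"
  have L: "l1_norm z \<le> int L" if "z \<in> S0" for z
  proof -
    have "l1_norm z \<le> Max (l1_norm ` S0)" using S0(1) that by (intro Max_ge) auto
    then show ?thesis by (simp add: L_def)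
  qed
  \<comment> \<open>The maximum with 1/2 keeps \<open>\<rho>\<close> positive for the logarithm,
    since \<open>dct_phi\<close> may be 0.\<close>
  define \<rho> where "\<rho> = max (dct_phi \<beta> S0 0) (1 / 2)"
  have \<rho>: "0 < \<rho>" "\<rho> < 1" "dct_phi \<beta> S0 0 \<le> \<rho>" using S0(3) by (auto simp: \<rho>_def)
  have phi: "0 \<le> dct_phi \<beta> S0 0"
    unfolding dct_phi_def using S0 \<beta>
    by (intro mult_nonneg_nonneg sum_nonneg corr_nonneg bdry_degree_nonneg) auto
  define l where "l = - ln \<rho>"
  have l: "0 < l" using \<rho> by (simp add: l_def)
  have "mag (nn \<beta>) V (nn \<beta> y) x \<le> exp l * exp (- (l / (real L + 1)) * real_of_int (l1_norm (x - y)))"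
    if V: "finite V" "x \<in> V" for V and x y :: "int ^ 'd"
  proof (cases "l1_norm (x - y) = 0")
    case True
    then show ?thesis using V l mag_le_1[of V "nn \<beta>" "nn \<beta> y" x] by (auto intro: order_trans[of _ 1])
  next
    case False
    \<comment> \<open>One less than the distance, because \<open>mag_decay\<close> with
      \<open>k\<close> steps asks for distance \<open>k * (L + 1) + 1\<close>.\<close>
    define n where "n = nat (l1_norm (x - y)) - 1"
    have n: "l1_norm (x - y) = int n + 1" using False l1_norm_nonneg[of "x - y"] by (simp add: n_def)
    define k where "k = n div (L + 1)"
    have "k * (L + 1) \<le> n" unfolding k_def by (rule div_times_less_eq_dividend)
    then have k_le: "int k * (int L + 1) + 1 \<le> l1_norm (x - y)"
      unfolding n by (metis add_le_cancel_right of_nat_1 of_nat_add of_nat_le_iff of_nat_mult)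
    have "mag (nn \<beta>) V (nn \<beta> y) x \<le> dct_phi \<beta> S0 0 ^ k"
      by (rule mag_decay[OF \<beta> V(1) S0(1,2)]) (use k_le L V(2) in auto)
    also have "\<dots> \<le> \<rho> ^ k" using \<rho> phi by (intro power_mono)
    also have "\<dots> = exp (- l * real k)"
      using exp_of_nat_mult[of k "ln \<rho>"] \<rho> by (simp add: l_def mult.commute)
    \<comment> \<open>The factor \<open>exp l\<close> pays for the remainder of the division by
      \<open>L + 1\<close>.\<close>
    also have "\<dots> \<le> exp (l + - (l / (real L + 1)) * (real n + 1))"
    proof -
      have "n + 1 \<le> (k + 1) * (L + 1)"
        using dividend_less_div_times[of "L + 1" n] by (simp add: k_def algebra_simps)
      then have "real (n + 1) \<le> real ((k + 1) * (L + 1))" by (simp only: of_nat_le_iff)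
      then have "real n + 1 \<le> (real k + 1) * (real L + 1)"
        unfolding of_nat_add of_nat_mult of_nat_1 .
      then have "(real n + 1) / (real L + 1) \<le> real k + 1"
        by (simp add: divide_le_eq)
      then have "l * ((real n + 1) / (real L + 1)) \<le> l * (real k + 1)"
        using l by (intro mult_left_mono) auto
      then show ?thesis by (simp add: algebra_simps)
    qed
    finally show ?thesis unfolding n exp_add by simp
  qed
  moreover have "0 < l / (real L + 1)" using l by simp
  ultimately show ?thesis by (intro exI[of _ "exp l"] exI[of _ "l / (real L + 1)"]) auto
qed

section \<open>Summing exponentials over the lattice\<close>

lemma sum_exp_abs_le:
  assumes "0 < c"
  shows "(\<Sum>k = - int N..int N. exp (- c * real_of_int \<bar>k\<bar>)) \<le> 2 / (1 - exp (- c))"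
proof -
  define r where "r = exp (- c)"
  have r: "0 < r" "r < 1" using assms by (auto simp: r_def)
  define f where "f k = exp (- c * real_of_int \<bar>k\<bar>)" for k :: int
  have f: "f (int n) = r ^ n" "f (- int n) = r ^ n" for n
    using exp_of_nat_mult[of n "- c"] by (simp_all add: f_def r_def mult.commute)
  have "sum f {- int N..int N} * (1 - r) = 1 + r - 2 * r ^ (N + 1)"
  proof (induction N)
    case 0
    then show ?case using f(1)[of 0] by simp
  next
    case (Suc N)
    have "{- int (Suc N)..int (Suc N)} = insert (int (Suc N)) (insert (- int (Suc N)) {- int N..int N})"
      by auto
    then have "sum f {- int (Suc N)..int (Suc N)} = 2 * r ^ Suc N + sum f {- int N..int N}"
      using f[of "Suc N"] by (simp del: of_nat_Suc)
    then show ?case by (simp only: distrib_right Suc.IH) (simp add: algebra_simps)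
  qed
  also have "\<dots> \<le> 2" using r by (smt (verit) zero_less_power)
  finally show ?thesis using r by (simp add: f_def r_def[symmetric] le_divide_eq)
qed

text \<open>A translation moves \<open>y\<close> to the origin. Over a box containing the translated
  set the exponential of the norm factors into one-dimensional sums, bounded uniformly in the size
  of the box.\<close>

lemma sum_exp_l1_norm_le:
  assumes "0 < c"
  shows "\<exists>M>0. \<forall>(F :: (int ^ 'd::finite) set) y. finite F \<longrightarrow>
    (\<Sum>x\<in>F. exp (- c * real_of_int (l1_norm (x - y)))) \<le> M"
proof -
  define M where "M = (2 / (1 - exp (- c))) ^ CARD('d)"
  have "(\<Sum>x\<in>F. exp (- c * real_of_int (l1_norm (x - y)))) \<le> M"
    if F: "finite F" for F :: "(int ^ 'd) set" and y
  proof -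
    define G where "G = (\<lambda>x. x - y) ` F"
    define N where "N = nat (Max (insert 0 (l1_norm ` G)))"
    have G: "finite G" using F by (simp add: G_def)
    have "G \<subseteq> lattice_box N"
    proof
      fix x assume "x \<in> G"
      then have "l1_norm x \<le> int N"
        using G Max_ge[of "insert 0 (l1_norm ` G)" "l1_norm x"] by (auto simp: N_def)
      moreover have "\<bar>x $ i\<bar> \<le> l1_norm x" for i
        unfolding l1_norm_def by (rule member_le_sum) auto
      ultimately have "\<bar>x $ i\<bar> \<le> int N" for i by (rule order_trans[rotated])
      then show "x \<in> lattice_box N" by (simp add: lattice_box_def abs_le_iff) (smt (verit))
    qed
    have bij: "bij_betw vec_nth (lattice_box N :: (int ^ 'd) set) (UNIV \<rightarrow>\<^sub>E {- int N..int N})"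
      by (rule bij_betw_byWitness[where f' = vec_lambda]) (auto simp: lattice_box_def)
    have "(\<Sum>x\<in>F. exp (- c * real_of_int (l1_norm (x - y)))) = (\<Sum>x\<in>G. exp (- c * real_of_int (l1_norm x)))"
      unfolding G_def by (subst sum.reindex) (auto simp: inj_on_def)
    also have "\<dots> \<le> (\<Sum>x\<in>lattice_box N. exp (- c * real_of_int (l1_norm (x :: int ^ 'd))))"
      by (intro sum_mono2 finite_lattice_box \<open>G \<subseteq> _\<close>) auto
    also have "\<dots> = (\<Sum>x\<in>lattice_box N. \<Prod>i\<in>UNIV. exp (- c * real_of_int \<bar>(x :: int ^ 'd) $ i\<bar>))"
      by (simp add: l1_norm_def exp_sum[symmetric] sum_distrib_left sum_negf)
    also have "\<dots> = (\<Sum>\<omega>\<in>UNIV \<rightarrow>\<^sub>E {- int N..int N}. \<Prod>i\<in>(UNIV :: 'd set). exp (- c * real_of_int \<bar>\<omega> i\<bar>))"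
      by (rule sum.reindex_bij_betw[OF bij])
    also have "\<dots> = (\<Prod>i\<in>(UNIV :: 'd set). \<Sum>k = - int N..int N. exp (- c * real_of_int \<bar>k\<bar>))"
      by (rule prod_sum_PiE[symmetric]) auto
    also have "\<dots> \<le> M"
      unfolding M_def using sum_exp_abs_le[OF assms, of N]
      by (auto intro!: power_mono sum_nonneg)
    finally show ?thesis .
  qed
  moreover have "0 < M" using assms by (simp add: M_def)
  ultimately show ?thesis by blast
qed

theorem corollary1p8:
  fixes \<beta> :: real
  assumes "CARD('d::finite) \<ge> 2"
    and "0 \<le> \<beta>" and "ereal \<beta> < critical_beta TYPE('d)"
  shows "\<exists>C m :: real. C > 0 \<and> m > 0 \<and>
    (\<forall>(V :: (int ^ 'd) set) (h :: int ^ 'd \<Rightarrow> real). finite V \<longrightarrow>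
      strong_spatial_mixing V (ising_measure V \<beta> h) C m)"
proof -
  \<comment> \<open>The strict inequality leaves room for \<open>\<beta>1\<close> above
    \<open>\<beta>\<close>; the differential inequality is used between the two.\<close>
  obtain \<beta>1 where \<beta>1: "\<beta> < \<beta>1" "(\<lambda>N. plus_magnetization TYPE('d) N \<beta>1) \<longlonglongrightarrow> 0"
    using assms(3) unfolding critical_beta_def less_Sup_iff by auto
  have "\<exists>S. finite S \<and> 0 \<in> S \<and> dct_phi \<beta> S (0 :: int ^ 'd) < 1"
  proof (rule exists_dct_phi_less_1[of lattice_box \<beta> \<beta>1])
    show "(\<lambda>N. plus_mag (lattice_box N) \<beta>1 (0 :: int ^ 'd)) \<longlonglongrightarrow> 0"
      using \<beta>1(2) by (simp only: plus_magnetization_eq)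
  qed (use assms(2) \<beta>1(1) finite_lattice_box in \<open>auto simp: lattice_box_def\<close>)
  then obtain S where "finite S" "0 \<in> S" "dct_phi \<beta> S (0 :: int ^ 'd) < 1" by blast
  from mag_exponential_decay[OF assms(2) this] obtain C m where Cm: "0 < C" "0 < m"
    and decay: "\<And>V (x :: int ^ 'd) y. finite V \<Longrightarrow> x \<in> V \<Longrightarrow>
      mag (nn \<beta>) V (nn \<beta> y) x \<le> C * exp (- m * real_of_int (l1_norm (x - y)))"
    by blast
  \<comment> \<open>Half of the rate gives the decay in the distance to \<open>\<Delta>\<close>, the
    other half makes the sum over \<open>\<Delta>\<close> converge.\<close>
  from Cm(2) have "0 < m / 2" by simp
  from sum_exp_l1_norm_le[OF this, where 'd = 'd] obtain M where M: "0 < M" "\<And>(F :: (int ^ 'd) set) y. finite F \<Longrightarrow>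
      (\<Sum>x\<in>F. exp (- (m / 2) * real_of_int (l1_norm (x - y)))) \<le> M"
    by blast
  have "strong_spatial_mixing V (ising_measure V \<beta> h) (C * M) (m / 2)"
    if V: "finite V" for V :: "(int ^ 'd) set" and h
    unfolding strong_spatial_mixing_def
  proof (intro allI impI cSUP_least)
    fix \<Delta> y \<tau>
    assume \<Delta>: "\<Delta> \<subseteq> V" and y: "y \<in> ext_boundary V" and \<tau>: "\<tau> \<in> spin_configs (ext_boundary V)"
    \<comment> \<open>For empty \<open>\<Delta>\<close> this value is unspecified, but then the sums
      over \<open>\<Delta>\<close> below are 0 and the estimates hold whatever it is.\<close>
    define D where "D = real_of_int (l1_setdist \<Delta> y)"
    have fin: "finite \<Delta>" using \<Delta> V by (rule finite_subset)
    have "tv_dist (marginal (ising_measure V \<beta> h \<tau>) \<Delta>) (marginal (ising_measure V \<beta> h (flip_spin \<tau> y)) \<Delta>)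
        \<le> (\<Sum>x\<in>\<Delta>. C * exp (- m * real_of_int (l1_norm (x - y))))"
      using decay by (intro tv_marginal_le V \<Delta> y assms(2) \<tau>)
    also have "\<dots> \<le> (\<Sum>x\<in>\<Delta>. C * (exp (- (m / 2) * D) * exp (- (m / 2) * real_of_int (l1_norm (x - y)))))"
    proof (intro sum_mono mult_left_mono)
      fix x assume "x \<in> \<Delta>"
      then have "l1_setdist \<Delta> y \<le> l1_norm (x - y)"
        using fin unfolding l1_setdist_def by (intro Min_le) auto
      then have "m / 2 * D \<le> m / 2 * real_of_int (l1_norm (x - y))"
        unfolding D_def using Cm(2) by (intro mult_left_mono) auto
      then show "exp (- m * real_of_int (l1_norm (x - y))) \<le>
          exp (- (m / 2) * D) * exp (- (m / 2) * real_of_int (l1_norm (x - y)))"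
        by (simp flip: exp_add)
    qed (use Cm in simp)
    also have "\<dots> = C * exp (- (m / 2) * D) * (\<Sum>x\<in>\<Delta>. exp (- (m / 2) * real_of_int (l1_norm (x - y))))"
      by (simp add: sum_distrib_left mult.assoc)
    also have "\<dots> \<le> C * exp (- (m / 2) * D) * M"
      using Cm fin by (intro mult_left_mono M(2)) auto
    finally show "tv_dist (marginal (ising_measure V \<beta> h \<tau>) \<Delta>) (marginal (ising_measure V \<beta> h (flip_spin \<tau> y)) \<Delta>)
        \<le> C * M * exp (- (m / 2) * real_of_int (l1_setdist \<Delta> y))"
      by (simp add: D_def mult_ac)
  qed (simp add: spin_configs_def PiE_eq_empty_iff)
  then show ?thesis using Cm M(1) by (intro exI[of _ "C * M"] exI[of _ "m / 2"]) auto
qed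

end
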